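(* Let $\frac12<H_1<H_2<1$ with $H_2-H_1>\frac14$, and let $\gamma>0$ be a constant. Then there exists a sequence $T_n\to\infty$ such that for every $n$ the integral equation $$\gamma^2u^{1-2H_1}=\gamma^2h(u)u^{1-2H_1}+\int_0^{T_n}h(s)\,k(s,u)\,ds,\qquad u\in(0,T_n],$$ has a unique solution $h=h_{T_n}$ in the class of functions $h$ on $(0,T_n]$ with $u\mapsto h(u)u^{1/2-H_1}\in L^2[0,T_n]$.
   Context: For $0<s<t$ let $$K_{H_1,H_2}(t,s)=\beta_{H_2}s^{1/2-H_2}\int_s^t (t-u)^{1/2-H_1}u^{H_2-H_1}(u-s)^{H_2-3/2}\,du,$$ and $K_{H_1,H_2}(t,s)=0$ for $s\ge t$, where $\beta_{H}=\big(H(2H-1)/\mathrm B(H-\frac12,2-2H)\big)^{1/2}$ and $\mathrm B$ is the Beta function. $\partial_tK_{H_1,H_2}(t,s)$ denotes the derivative in the first variable. For $s,u>0$, $$k(s,u)=\int_0^{s\wedge u}\partial_sK_{H_1,H_2}(s,v)\,\partial_uK_{H_1,H_2}(u,v)\,dv.$$ (In the paper $\gamma=\gamma_{H_1}$ is the normalizing constant of the Molchan martingale of a fractional Brownian motion with index $H_1$.) *)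

theory Defs
  imports "HOL-Analysis.Analysis"
begin

definition beta_const :: "real \<Rightarrow> real" where
  "beta_const H = sqrt (H * (2 * H - 1) / Beta (H - 1/2) (2 - 2 * H))"

definition Kker :: "real \<Rightarrow> real \<Rightarrow> real \<Rightarrow> real \<Rightarrow> real" where
  "Kker H1 H2 t s =
     (if 0 < s \<and> s < t then
        beta_const H2 * s powr (1/2 - H2) *
          (LBINT u:{s<..<t}. (t - u) powr (1/2 - H1) * u powr (H2 - H1) * (u - s) powr (H2 - 3/2))
      else 0)"

definition kker :: "real \<Rightarrow> real \<Rightarrow> real \<Rightarrow> real \<Rightarrow> real" where
  "kker H1 H2 s u =
     (LBINT v:{0<..<min s u}. deriv (\<lambda>t. Kker H1 H2 t v) s * deriv (\<lambda>t. Kker H1 H2 t v) u)"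

definition admissible :: "real \<Rightarrow> real \<Rightarrow> (real \<Rightarrow> real) \<Rightarrow> bool" where
  "admissible H1 T h \<longleftrightarrow>
     set_borel_measurable lborel {0..T} (\<lambda>u. h u * u powr (1/2 - H1)) \<and>
     set_integrable lborel {0..T} (\<lambda>u. (h u * u powr (1/2 - H1))\<^sup>2)"

definition solves_eq :: "real \<Rightarrow> real \<Rightarrow> real \<Rightarrow> real \<Rightarrow> (real \<Rightarrow> real) \<Rightarrow> bool" where
  "solves_eq H1 H2 \<gamma> T h \<longleftrightarrow>
     (\<forall>u\<in>{0<..T}.
        set_integrable lborel {0<..T} (\<lambda>s. h s * kker H1 H2 s u) \<and>
        \<gamma>\<^sup>2 * u powr (1 - 2 * H1) =
          \<gamma>\<^sup>2 * h u * u powr (1 - 2 * H1) + (LBINT s:{0<..T}. h s * kker H1 H2 s u))"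

end

theory Submission
  imports Defs
begin

text \<open>Put \<open>f u = h u * u powr (1/2 - H1)\<close>. The equation becomes \<open>\<gamma>\<^sup>2 f + A f = b\<close> in \<open>L\<^sup>2\<close>, where
  \<open>A\<close> is the integral operator with the Gram kernel \<open>\<kappa> s u = \<integral>v. D s v * D u v\<close> and
  \<open>D s v = s powr (H1 - 1/2) * \<partial>\<^sub>s K(s, v)\<close>. Such an operator is positive semidefinite, so
  \<open>\<gamma>\<^sup>2 + A\<close> is invertible as soon as \<open>A\<close> is bounded; no \<open>T > 0\<close> has to be excluded. Bounding
  \<open>\<partial>\<^sub>t K(t, v)\<close> by a multiple of \<open>t powr a * v powr (1/2 - H2) * (t - v) powr (a - 1)\<close> with
  \<open>a = H2 - H1\<close> shows that \<open>\<kappa>\<close> has a singularity slightly weaker than \<open>\<bar>s - u\<bar> powr - (1/2)\<close> when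
  \<open>a > 1/4\<close>. Hence \<open>\<kappa>\<close> is Hilbert-Schmidt, and each section \<open>\<kappa> _ u\<close> is square integrable, which
  gives the equation at every \<open>u\<close> and not only almost everywhere.\<close>

section \<open>Square integrable functions\<close>

text \<open>Actual functions instead of classes modulo null sets, because the equation has to hold
  at every point.\<close>

definition sq_integrable :: "'a measure \<Rightarrow> ('a \<Rightarrow> real) \<Rightarrow> bool" where
  "sq_integrable M f \<longleftrightarrow> f \<in> borel_measurable M \<and> integrable M (\<lambda>x. (f x)\<^sup>2)"

lemma sq_integrable_measurable: "sq_integrable M f \<Longrightarrow> f \<in> borel_measurable M"
  by (simp add: sq_integrable_def)

lemma sq_integrable_square: "sq_integrable M f \<Longrightarrow> integrable M (\<lambda>x. (f x)\<^sup>2)"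
  by (simp add: sq_integrable_def)

lemma integrable_mult_sq_integrable:
  assumes "sq_integrable M f" "sq_integrable M g"
  shows "integrable M (\<lambda>x. f x * g x)"
proof (rule Bochner_Integration.integrable_bound)
  show "integrable M (\<lambda>x. (f x)\<^sup>2 + (g x)\<^sup>2)"
    using assms by (simp add: sq_integrable_def)
  show "(\<lambda>x. f x * g x) \<in> borel_measurable M"
    using assms by (auto simp: sq_integrable_def)
  show "AE x in M. norm (f x * g x) \<le> norm ((f x)\<^sup>2 + (g x)\<^sup>2)"
  proof (rule AE_I2)
    fix x
    have "0 \<le> (\<bar>f x\<bar> - \<bar>g x\<bar>)\<^sup>2" "0 \<le> (f x)\<^sup>2" "0 \<le> (g x)\<^sup>2" by simp_all
    then show "norm (f x * g x) \<le> norm ((f x)\<^sup>2 + (g x)\<^sup>2)"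
      using mult_nonneg_nonneg[of "\<bar>f x\<bar>" "\<bar>g x\<bar>"] unfolding power2_diff by (simp add: abs_mult del: mult_nonneg_nonneg)
  qed
qed

lemma sq_integrable_cmult: "sq_integrable M f \<Longrightarrow> sq_integrable M (\<lambda>x. c * f x)"
  by (auto simp: sq_integrable_def power_mult_distrib)

lemma sq_integrable_add:
  assumes "sq_integrable M f" "sq_integrable M g"
  shows "sq_integrable M (\<lambda>x. f x + g x)"
  using assms integrable_mult_sq_integrable[OF assms]
  by (auto simp: sq_integrable_def power2_sum mult.assoc)

lemma sq_integrable_diff:
  assumes "sq_integrable M f" "sq_integrable M g"
  shows "sq_integrable M (\<lambda>x. f x - g x)"
  using sq_integrable_add[OF assms(1) sq_integrable_cmult[OF assms(2), of "-1"]] by simp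

lemma sq_integrable_abs: "sq_integrable M f \<Longrightarrow> sq_integrable M (\<lambda>x. \<bar>f x\<bar>)"
  by (auto simp: sq_integrable_def)

lemma sq_integrable_bound:
  assumes "sq_integrable M g" "f \<in> borel_measurable M" "\<And>x. x \<in> space M \<Longrightarrow> \<bar>f x\<bar> \<le> \<bar>g x\<bar>"
  shows "sq_integrable M f"
  unfolding sq_integrable_def
proof
  show "integrable M (\<lambda>x. (f x)\<^sup>2)"
    using assms(2,3)
    by (intro Bochner_Integration.integrable_bound[OF sq_integrable_square[OF assms(1)]] AE_I2)
       (auto simp: abs_le_square_iff)
qed fact

text \<open>Cauchy-Schwarz: the integral of \<open>(t * f x + g x)\<^sup>2\<close> is a quadratic
  polynomial in \<open>t\<close> that is never negative.\<close>

lemma integral_mult_square_le: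
  assumes "sq_integrable M f" "sq_integrable M g"
  shows "(\<integral>x. f x * g x \<partial>M)\<^sup>2 \<le> (\<integral>x. (f x)\<^sup>2 \<partial>M) * (\<integral>x. (g x)\<^sup>2 \<partial>M)"
proof -
  define A B C where "A = (\<integral>x. (f x)\<^sup>2 \<partial>M)" "B = (\<integral>x. f x * g x \<partial>M)" "C = (\<integral>x. (g x)\<^sup>2 \<partial>M)"
  note fg = integrable_mult_sq_integrable[OF assms]
  have quad: "0 \<le> t\<^sup>2 * A + 2 * t * B + C" for t
  proof -
    have "(\<integral>x. (t * f x + g x)\<^sup>2 \<partial>M) = (\<integral>x. t\<^sup>2 * (f x)\<^sup>2 + 2 * t * (f x * g x) + (g x)\<^sup>2 \<partial>M)"
      by (simp add: power2_sum algebra_simps)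
    also have "\<dots> = t\<^sup>2 * A + 2 * t * B + C"
      using assms fg unfolding A_B_C_def sq_integrable_def by simp
    finally show ?thesis
      using Bochner_Integration.integral_nonneg[of M "\<lambda>x. (t * f x + g x)\<^sup>2"] by simp
  qed
  have "A \<ge> 0" unfolding A_B_C_def by simp
  have "B\<^sup>2 \<le> A * C"
  proof (cases "A = 0")
    case True
    \<comment> \<open>The polynomial is now \<open>2 * t * B + C\<close>; for nonzero
      \<open>B\<close> the chosen \<open>t\<close> would give it the value -1.\<close>
    have "B = 0"
    proof (rule ccontr)
      assume "B \<noteq> 0"
      then show False using quad[of "-(C+1)/(2*B)"] True by (simp add: field_simps)
    qed
    then show ?thesis using True by simp
  next
    case False
    \<comment> \<open>\<open>t = -B/A\<close> is the minimiser of the polynomial.\<close>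
    have "(-B/A)\<^sup>2 * A + 2 * (-B/A) * B + C = C - B\<^sup>2 / A"
      using False by (simp add: power2_eq_square)
    then have "B\<^sup>2 / A \<le> C" using quad[of "-B/A"] by linarith
    then show ?thesis using False \<open>A \<ge> 0\<close> by (simp add: field_simps)
  qed
  then show ?thesis unfolding A_B_C_def .
qed

section \<open>Equations of the second kind with a Gram kernel\<close>

text \<open>Since \<open>D\<close> is nonnegative, absolute convergence of the triple integral
  behind the quadratic form reduces to properties of \<kappa>. Integrability in \<open>v\<close> is
  asked for almost every \<open>s\<close> only, because it can fail on the diagonal; the sections of
  \<kappa> are square integrable at every \<open>u\<close>, which gives pointwise control.\<close>

locale gram_kernel = M: sigma_finite_measure M + N: sigma_finite_measure N
  for M :: "'a measure" and N :: "'b measure" +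
  fixes D :: "'a \<Rightarrow> 'b \<Rightarrow> real" and \<kappa> :: "'a \<Rightarrow> 'a \<Rightarrow> real"
  assumes kernel_eq: "\<kappa> s u = (\<integral>v. D s v * D u v \<partial>N)"
    and D_measurable [measurable]: "case_prod D \<in> borel_measurable (M \<Otimes>\<^sub>M N)"
    and D_nonneg: "0 \<le> D s v"
    and D_integrable: "u \<in> space M \<Longrightarrow> AE s in M. integrable N (\<lambda>v. D s v * D u v)"
    and kernel_sq_integrable: "u \<in> space M \<Longrightarrow> integrable M (\<lambda>s. (\<kappa> s u)\<^sup>2)"
    and kernel_Hilbert_Schmidt: "integrable M (\<lambda>u. \<integral>s. (\<kappa> s u)\<^sup>2 \<partial>M)"
begin

sublocale MM: pair_sigma_finite M M ..
sublocale MMN: pair_sigma_finite "M \<Otimes>\<^sub>M M" N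
  using MM.sigma_finite_measure_axioms N.sigma_finite_measure_axioms by (rule pair_sigma_finite.intro)

section \<open>The integral operator and its positivity\<close>

definition A :: "('a \<Rightarrow> real) \<Rightarrow> 'a \<Rightarrow> real" where
  "A f u = (\<integral>s. f s * \<kappa> s u \<partial>M)"

text \<open>Controls \<open>(A f u)\<^sup>2\<close> pointwise by Cauchy-Schwarz; its integral is the
  squared Hilbert-Schmidt norm of \<open>A\<close>.\<close>

definition g :: "'a \<Rightarrow> real" where
  "g u = (\<integral>s. (\<kappa> s u)\<^sup>2 \<partial>M)"

lemma kernel_measurable [measurable]: "(\<lambda>(s, u). \<kappa> s u) \<in> borel_measurable (M \<Otimes>\<^sub>M M)"
  unfolding kernel_eq by measurable

lemma kernel_nonneg: "0 \<le> \<kappa> s u"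
  unfolding kernel_eq by (intro Bochner_Integration.integral_nonneg) (simp add: D_nonneg)

lemma g_nonneg: "0 \<le> g u"
  by (simp add: g_def)

lemma g_measurable [measurable]: "g \<in> borel_measurable M"
  unfolding g_def by measurable

lemma g_integrable: "integrable M g"
  using kernel_Hilbert_Schmidt unfolding g_def .

lemma sq_integrable_kernel: "u \<in> space M \<Longrightarrow> sq_integrable M (\<lambda>s. \<kappa> s u)"
  unfolding sq_integrable_def using kernel_sq_integrable by simp

lemma integrable_kernel:
  assumes "sq_integrable M f" "u \<in> space M"
  shows "integrable M (\<lambda>s. f s * \<kappa> s u)"
  using integrable_mult_sq_integrable[OF assms(1) sq_integrable_kernel[OF assms(2)]] .

text \<open>Valid at every point, so it converts \<open_L2>-free norm information into pointwise
  information: a function of norm zero has image zero everywhere.\<close>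

lemma A_square_le:
  assumes "sq_integrable M f" "u \<in> space M"
  shows "(A f u)\<^sup>2 \<le> (\<integral>s. (f s)\<^sup>2 \<partial>M) * g u"
  unfolding A_def g_def by (rule integral_mult_square_le[OF assms(1) sq_integrable_kernel[OF assms(2)]])

lemma sq_integrable_A:
  assumes "sq_integrable M f"
  shows "sq_integrable M (A f)"
  unfolding sq_integrable_def
proof
  have [measurable]: "f \<in> borel_measurable M" using assms by (rule sq_integrable_measurable)
  show *: "A f \<in> borel_measurable M"
    unfolding A_def by measurable
  show "integrable M (\<lambda>u. (A f u)\<^sup>2)"
    using * A_square_le[OF assms] g_nonneg
    by (intro Bochner_Integration.integrable_bound[OF integrable_mult_right[OF g_integrable,
          of "\<integral>s. (f s)\<^sup>2 \<partial>M"]] AE_I2)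
       (auto simp: abs_mult)
qed

lemma A_norm_le:
  assumes "sq_integrable M f"
  shows "(\<integral>u. (A f u)\<^sup>2 \<partial>M) \<le> (\<integral>s. (f s)\<^sup>2 \<partial>M) * (\<integral>u. g u \<partial>M)"
proof -
  have "(\<integral>u. (A f u)\<^sup>2 \<partial>M) \<le> (\<integral>u. (\<integral>s. (f s)\<^sup>2 \<partial>M) * g u \<partial>M)"
    using sq_integrable_square[OF sq_integrable_A[OF assms]] g_integrable A_square_le[OF assms]
    by (intro integral_mono) auto
  then show ?thesis by simp
qed

lemma A_linear:
  assumes "sq_integrable M f" "sq_integrable M f'" "u \<in> space M"
  shows "A (\<lambda>s. a * f s + b * f' s) u = a * A f u + b * A f' u"
proof -
  have "A (\<lambda>s. a * f s + b * f' s) u = (\<integral>s. a * (f s * \<kappa> s u) + b * (f' s * \<kappa> s u) \<partial>M)"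
    unfolding A_def by (simp add: algebra_simps)
  then show ?thesis
    using integrable_kernel[OF assms(1,3)] integrable_kernel[OF assms(2,3)] by (simp add: A_def)
qed

text \<open>By Fubini the quadratic form is the integral over \<open>v\<close> of the square of
  \<open>\<integral>s. f s * D s v \<partial>M\<close>.\<close>

lemma A_positive:
  assumes f: "sq_integrable M f"
  shows "0 \<le> (\<integral>u. f u * A f u \<partial>M)"
proof -
  have fm [measurable]: "f \<in> borel_measurable M" using f by (rule sq_integrable_measurable)
  define F where "F = (\<lambda>(p, v). (f (fst p) * D (fst p) v) * (f (snd p) * D (snd p) v))"
  have Fm [measurable]: "F \<in> borel_measurable ((M \<Otimes>\<^sub>M M) \<Otimes>\<^sub>M N)"
    unfolding F_def by measurable
  have Fn: "ennreal (norm (F ((u, s), v))) = ennreal (\<bar>f u\<bar> * \<bar>f s\<bar>) * ennreal (D s v * D u v)" for u s v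
    by (simp add: F_def abs_mult D_nonneg mult_ac flip: ennreal_mult)
  have inner: "AE s in M. (\<integral>\<^sup>+v. ennreal (norm (F ((u, s), v))) \<partial>N) = ennreal (\<bar>f u\<bar> * (\<bar>f s\<bar> * \<kappa> s u))"
    if u: "u \<in> space M" for u
    using D_integrable[OF u] AE_space
  proof eventually_elim
    case (elim s)
    have [measurable]: "(\<lambda>v. D s v) \<in> borel_measurable N" "(\<lambda>v. D u v) \<in> borel_measurable N"
      using elim u by measurable
    have "(\<integral>\<^sup>+v. ennreal (norm (F ((u, s), v))) \<partial>N)
        = ennreal (\<bar>f u\<bar> * \<bar>f s\<bar>) * (\<integral>\<^sup>+v. ennreal (D s v * D u v) \<partial>N)"
      unfolding Fn by (rule nn_integral_cmult) measurable
    also have "(\<integral>\<^sup>+v. ennreal (D s v * D u v) \<partial>N) = ennreal (\<kappa> s u)"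
      unfolding kernel_eq using elim D_nonneg by (intro nn_integral_eq_integral) auto
    finally show ?case by (simp add: mult.assoc kernel_nonneg flip: ennreal_mult)
  qed
  have fa: "sq_integrable M (\<lambda>s. \<bar>f s\<bar>)" using sq_integrable_abs[OF f] .
  have Aa0: "0 \<le> A (\<lambda>s. \<bar>f s\<bar>) u" for u
    unfolding A_def by (intro Bochner_Integration.integral_nonneg) (simp add: kernel_nonneg)
  \<comment> \<open>Tonelli turns the integral of \<open>norm F\<close> into the quadratic form of
    \<open>\<bar>f\<bar>\<close>, which is finite as a product of two square integrable functions.
    This justifies the exchange of integrals below.\<close>
  have "(\<integral>\<^sup>+p. \<integral>\<^sup>+v. ennreal (norm (F (p, v))) \<partial>N \<partial>(M \<Otimes>\<^sub>M M))
      = (\<integral>\<^sup>+u. \<integral>\<^sup>+s. \<integral>\<^sup>+v. ennreal (norm (F ((u, s), v))) \<partial>N \<partial>M \<partial>M)"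
    by (subst M.nn_integral_fst[symmetric]) auto
  also have "\<dots> = (\<integral>\<^sup>+u. ennreal (\<bar>f u\<bar> * A (\<lambda>s. \<bar>f s\<bar>) u) \<partial>M)"
  proof (rule nn_integral_cong)
    fix u assume u: "u \<in> space M"
    have "(\<integral>\<^sup>+s. \<integral>\<^sup>+v. ennreal (norm (F ((u, s), v))) \<partial>N \<partial>M)
        = (\<integral>\<^sup>+s. ennreal (\<bar>f u\<bar> * (\<bar>f s\<bar> * \<kappa> s u)) \<partial>M)"
      by (rule nn_integral_cong_AE) (rule inner[OF u])
    also have "\<dots> = ennreal (\<integral>s. \<bar>f u\<bar> * (\<bar>f s\<bar> * \<kappa> s u) \<partial>M)"
      using integrable_kernel[OF fa u] by (intro nn_integral_eq_integral) (auto simp: kernel_nonneg)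
    finally show "(\<integral>\<^sup>+s. \<integral>\<^sup>+v. ennreal (norm (F ((u, s), v))) \<partial>N \<partial>M) = ennreal (\<bar>f u\<bar> * A (\<lambda>s. \<bar>f s\<bar>) u)"
      by (simp add: A_def)
  qed
  also have "\<dots> = ennreal (\<integral>u. \<bar>f u\<bar> * A (\<lambda>s. \<bar>f s\<bar>) u \<partial>M)"
    using integrable_mult_sq_integrable[OF fa sq_integrable_A[OF fa]]
    by (intro nn_integral_eq_integral) (auto simp: Aa0)
  also have "\<dots> < \<infinity>" by simp
  finally have "(\<integral>\<^sup>+z. ennreal (norm (F z)) \<partial>((M \<Otimes>\<^sub>M M) \<Otimes>\<^sub>M N)) < \<infinity>"
    by (subst (asm) N.nn_integral_fst) auto
  then have F_int: "integrable ((M \<Otimes>\<^sub>M M) \<Otimes>\<^sub>M N) F"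
    by (intro integrableI_bounded) auto
  have swap: "(\<integral>v. \<integral>p. F (p, v) \<partial>(M \<Otimes>\<^sub>M M) \<partial>N) = (\<integral>p. \<integral>v. F (p, v) \<partial>N \<partial>(M \<Otimes>\<^sub>M M))"
    using MMN.Fubini_integral[of "\<lambda>p v. F (p, v)"] F_int by simp
  have "AE v in N. integrable (M \<Otimes>\<^sub>M M) (\<lambda>p. F (p, v))"
    using MMN.AE_integrable_snd[of "\<lambda>p v. F (p, v)"] F_int by simp
  \<comment> \<open>For fixed \<open>v\<close> the integrand is a product in \<open>u\<close> and
    \<open>s\<close> of the same factor, so its double integral is a square.\<close>
  then have "AE v in N. 0 \<le> (\<integral>p. F (p, v) \<partial>(M \<Otimes>\<^sub>M M))"
  proof eventually_elim
    case (elim v)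
    have "(\<integral>p. F (p, v) \<partial>(M \<Otimes>\<^sub>M M)) = (\<integral>u. \<integral>s. F ((u, s), v) \<partial>M \<partial>M)"
      using MM.integral_fst'[OF elim] by simp
    also have "\<dots> = (\<integral>s. f s * D s v \<partial>M) * (\<integral>s. f s * D s v \<partial>M)"
      by (simp add: F_def)
    finally show ?case by simp
  qed
  then have "0 \<le> (\<integral>v. \<integral>p. F (p, v) \<partial>(M \<Otimes>\<^sub>M M) \<partial>N)"
    by (rule integral_nonneg_AE)
  also have "\<dots> = (\<integral>u. \<integral>s. \<integral>v. F ((u, s), v) \<partial>N \<partial>M \<partial>M)"
    unfolding swap using MM.integral_fst'[OF MMN.integrable_fst'[OF F_int]] by simp
  also have "\<dots> = (\<integral>u. f u * A f u \<partial>M)"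
  proof (intro Bochner_Integration.integral_cong refl)
    fix u
    have "(\<integral>v. F ((u, s), v) \<partial>N) = f u * (f s * \<kappa> s u)" for s
    proof -
      have "(\<integral>v. F ((u, s), v) \<partial>N) = (\<integral>v. (f u * f s) * (D s v * D u v) \<partial>N)"
        by (simp add: F_def mult_ac)
      then show ?thesis by (simp add: kernel_eq mult_ac)
    qed
    then show "(\<integral>s. \<integral>v. F ((u, s), v) \<partial>N \<partial>M) = f u * A f u"
      by (simp add: A_def)
  qed
  finally show ?thesis .
qed

section \<open>Uniqueness\<close>

text \<open>Testing the equation with \<open>f\<close> and using positivity gives \<open>f\<close>
  norm zero. Then \<open>A f u\<close> vanishes at every \<open>u\<close> by
  \<open>A_square_le\<close>, and the equation itself upgrades \<open>f = 0\<close> from almost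
  everywhere to everywhere.\<close>

lemma homogeneous_solution_zero:
  assumes f: "sq_integrable M f" and c: "0 < c"
    and eq: "\<And>u. u \<in> space M \<Longrightarrow> c * f u + A f u = 0" and u: "u \<in> space M"
  shows "f u = 0"
proof -
  have "0 \<le> (\<integral>u. f u * A f u \<partial>M)" by (rule A_positive[OF f])
  also have "\<dots> = (\<integral>u. - c * (f u)\<^sup>2 \<partial>M)"
  proof (intro Bochner_Integration.integral_cong refl)
    fix u assume "u \<in> space M"
    then have "A f u = - c * f u" using eq[of u] by simp
    then show "f u * A f u = - c * (f u)\<^sup>2" by (simp add: power2_eq_square)
  qed
  finally have "c * (\<integral>u. (f u)\<^sup>2 \<partial>M) \<le> 0" by simp
  then have "(\<integral>u. (f u)\<^sup>2 \<partial>M) \<le> 0" using c by (simp add: mult_le_0_iff)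
  then have "(\<integral>u. (f u)\<^sup>2 \<partial>M) = 0" by (simp add: antisym)
  then have "(A f u)\<^sup>2 \<le> 0" using A_square_le[OF f u] by simp
  then show ?thesis using eq[OF u] c by simp
qed

theorem unique_solution:
  assumes "sq_integrable M f" "sq_integrable M f'" "0 < c"
    and "\<And>u. u \<in> space M \<Longrightarrow> c * f u + A f u = b u"
    and "\<And>u. u \<in> space M \<Longrightarrow> c * f' u + A f' u = b u" and "u \<in> space M"
  shows "f u = f' u"
proof -
  have "c * (f u - f' u) + A (\<lambda>s. f s - f' s) u = 0" if "u \<in> space M" for u
    using A_linear[OF assms(1,2) that, of 1 "-1"] assms(4,5)[OF that] by (simp add: algebra_simps)
  from homogeneous_solution_zero[OF sq_integrable_diff[OF assms(1,2)] assms(3) this assms(6)]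
  show ?thesis by simp
qed

section \<open>Existence by a damped Neumann series\<close>

lemma damped_contraction:
  assumes w: "sq_integrable M w" and "0 \<le> \<tau>" "0 \<le> 1 - \<tau> * c"
  shows "(\<integral>u. ((1 - \<tau> * c) * w u - \<tau> * A w u)\<^sup>2 \<partial>M)
    \<le> ((1 - \<tau> * c)\<^sup>2 + \<tau>\<^sup>2 * (\<integral>u. g u \<partial>M)) * (\<integral>u. (w u)\<^sup>2 \<partial>M)"
proof -
  define r where "r = 1 - \<tau> * c"
  have Aw: "sq_integrable M (A w)" using sq_integrable_A[OF w] .
  have "(\<integral>u. (r * w u - \<tau> * A w u)\<^sup>2 \<partial>M)
      = (\<integral>u. r\<^sup>2 * (w u)\<^sup>2 + \<tau>\<^sup>2 * (A w u)\<^sup>2 - 2 * r * \<tau> * (w u * A w u) \<partial>M)"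
    by (simp add: power2_diff power_mult_distrib mult_ac)
  also have "\<dots> = r\<^sup>2 * (\<integral>u. (w u)\<^sup>2 \<partial>M) + \<tau>\<^sup>2 * (\<integral>u. (A w u)\<^sup>2 \<partial>M) - 2 * r * \<tau> * (\<integral>u. w u * A w u \<partial>M)"
    using sq_integrable_square[OF w] sq_integrable_square[OF Aw] integrable_mult_sq_integrable[OF w Aw]
    by simp
  also have "\<dots> \<le> r\<^sup>2 * (\<integral>u. (w u)\<^sup>2 \<partial>M) + \<tau>\<^sup>2 * ((\<integral>u. (w u)\<^sup>2 \<partial>M) * (\<integral>u. g u \<partial>M))"
  proof -
    have "0 \<le> 2 * r * \<tau> * (\<integral>u. w u * A w u \<partial>M)"
      using A_positive[OF w] assms(2,3) by (simp add: r_def)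
    with mult_left_mono[OF A_norm_le[OF w], of "\<tau>\<^sup>2"] show ?thesis
      by (smt (verit) zero_le_power2)
  qed
  finally show ?thesis by (simp add: r_def algebra_simps)
qed

text \<open>Since \<open>A\<close> is positive, \<open>1 - \<tau> (c + A)\<close> is a contraction of \<open>L\<^sup>2\<close> for small \<open>\<tau>\<close>. The
  resulting Neumann series converges at every point, dominated by a square integrable function,
  because \<open>A w u\<close> is bounded by the \<open>L\<^sup>2\<close> norm of \<open>w\<close>; completeness of \<open>L\<^sup>2\<close> is not needed.\<close>

theorem ex_solution:
  assumes b: "sq_integrable M b" and c: "0 < c"
  obtains f where "sq_integrable M f" "\<And>u. u \<in> space M \<Longrightarrow> c * f u + A f u = b u"
proof -
  define G where "G = (\<integral>u. g u \<partial>M)"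
  have G0: "0 \<le> G" unfolding G_def by (intro Bochner_Integration.integral_nonneg) (rule g_nonneg)
  have cG: "0 < c\<^sup>2 + G" using c G0 by (simp add: add_pos_nonneg)
  \<comment> \<open>This \<tau> minimises
    \<open>(1 - \<tau> * c)\<^sup>2 + \<tau>\<^sup>2 * G\<close>; the minimal value is
    \<open>1 - \<tau> * c\<close> itself, which is \<open>r_eq\<close>.\<close>
  define \<tau> where "\<tau> = c / (c\<^sup>2 + G)"
  have \<tau>: "0 < \<tau>" using c cG by (simp add: \<tau>_def)
  define r where "r = 1 - \<tau> * c"
  have r: "0 \<le> r" "r < 1"
    using c cG G0 \<tau> by (simp_all add: r_def \<tau>_def power2_eq_square field_simps)
  have r_eq: "r\<^sup>2 + \<tau>\<^sup>2 * G = r"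
  proof -
    have "\<tau> * (c\<^sup>2 + G) = c" using cG by (simp add: \<tau>_def)
    then have "\<tau> * (\<tau> * (c\<^sup>2 + G)) = \<tau> * c" by simp
    then show ?thesis unfolding r_def by (simp add: power2_eq_square algebra_simps)
  qed
  define q where "q = sqrt r"
  have q: "0 \<le> q" "q < 1" "q\<^sup>2 = r"
    using r by (simp_all add: q_def)
  have rq: "r \<le> q"
    unfolding q_def by (rule real_le_rsqrt) (use r mult_left_le[of r r] in \<open>simp add: power2_eq_square\<close>)
  \<comment> \<open>A rate strictly between \<open>q\<close> and 1, so that
    \<open>\<rho> - r\<close> is positive even when \<open>r = q\<close>, as happens for
    \<open>G = 0\<close>.\<close>
  define \<rho> where "\<rho> = (1 + q) / 2"
  have \<rho>: "q < \<rho>" "\<rho> < 1" "0 < \<rho>" "r < \<rho>" using q rq by (auto simp: \<rho>_def)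
  \<comment> \<open>\<open>w n\<close> is the \<open>n\<close>-th iterate of
    \<open>1 - \<tau> * (c + A)\<close> applied to \<open>\<tau> * b\<close>; formally the sum over
    \<open>n\<close> is the inverse of \<open>c + A\<close> applied to \<open>b\<close>.\<close>
  define w where "w = rec_nat (\<lambda>u. \<tau> * b u) (\<lambda>_ w u. r * w u - \<tau> * A w u)"
  have w0: "w 0 = (\<lambda>u. \<tau> * b u)" and wS: "w (Suc n) = (\<lambda>u. r * w n u - \<tau> * A (w n) u)" for n
    by (simp_all add: w_def)
  have wI: "sq_integrable M (w n)" for n
    by (induction n) (auto simp: w0 wS intro!: sq_integrable_cmult b sq_integrable_diff sq_integrable_A)
  have [measurable]: "w n \<in> borel_measurable M" for n
    using wI by (rule sq_integrable_measurable)
  define W where "W = sqrt (\<integral>u. (w 0 u)\<^sup>2 \<partial>M)"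
  have W0: "0 \<le> W" by (simp add: W_def)
  have wN: "(\<integral>u. (w n u)\<^sup>2 \<partial>M) \<le> (q ^ n * W)\<^sup>2" for n
  proof (induction n)
    case 0 then show ?case by (simp add: W_def)
  next
    case (Suc n)
    have "(\<integral>u. (w (Suc n) u)\<^sup>2 \<partial>M) \<le> (r\<^sup>2 + \<tau>\<^sup>2 * G) * (\<integral>u. (w n u)\<^sup>2 \<partial>M)"
      unfolding wS r_def G_def using damped_contraction[OF wI[of n], of \<tau> c] \<tau> r by (simp add: r_def)
    also have "\<dots> \<le> r * (q ^ n * W)\<^sup>2"
      unfolding r_eq using Suc r by (intro mult_left_mono) auto
    also have "\<dots> = (q ^ Suc n * W)\<^sup>2"
      by (simp add: q(3)[symmetric] power_mult_distrib mult_ac)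
    finally show ?case .
  qed
  \<comment> \<open>Chosen to dominate \<open>\<bar>w 0\<bar>\<close> and to satisfy
    \<open>r * E u + \<tau> * W * sqrt (g u) \<le> \<rho> * E u\<close>, which closes the induction
    for \<open>wE\<close>.\<close>
  define E where "E = (\<lambda>u. \<bar>w 0 u\<bar> + (\<tau> * W / (\<rho> - r)) * sqrt (g u))"
  have g2: "sq_integrable M (\<lambda>u. sqrt (g u))"
    using g_integrable by (simp add: sq_integrable_def g_nonneg)
  have EI: "sq_integrable M E"
    unfolding E_def by (intro sq_integrable_add sq_integrable_abs sq_integrable_cmult g2 wI)
  have E0: "0 \<le> E u" for u
    unfolding E_def using \<tau> W0 \<rho> g_nonneg by (intro add_nonneg_nonneg mult_nonneg_nonneg) auto
  have wE: "\<bar>w n u\<bar> \<le> \<rho> ^ n * E u" if u: "u \<in> space M" for n u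
  proof (induction n)
    case 0
    show ?case using \<tau> W0 \<rho> g_nonneg[of u] by (simp add: E_def)
  next
    case (Suc n)
    have "(A (w n) u)\<^sup>2 \<le> (q ^ n * W)\<^sup>2 * g u"
      using A_square_le[OF wI[of n] u] mult_right_mono[OF wN[of n] g_nonneg[of u]] by linarith
    also have "\<dots> = (q ^ n * W * sqrt (g u))\<^sup>2"
      by (simp add: power_mult_distrib g_nonneg)
    finally have "\<bar>A (w n) u\<bar> \<le> \<bar>q ^ n * W * sqrt (g u)\<bar>"
      by (simp only: abs_le_square_iff)
    then have "\<bar>A (w n) u\<bar> \<le> q ^ n * W * sqrt (g u)"
      using q(1) W0 g_nonneg[of u] by simp
    also have "\<dots> \<le> \<rho> ^ n * W * sqrt (g u)"
      using q \<rho> W0 g_nonneg[of u] by (intro mult_right_mono power_mono) auto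
    finally have A1: "\<tau> * \<bar>A (w n) u\<bar> \<le> \<tau> * (\<rho> ^ n * W * sqrt (g u))"
      using \<tau> by simp
    have "\<tau> * (W * sqrt (g u)) \<le> (\<rho> - r) * E u"
    proof -
      have "(\<rho> - r) * E u = (\<rho> - r) * \<bar>w 0 u\<bar> + \<tau> * (W * sqrt (g u))"
        using \<rho> by (simp add: E_def distrib_left)
      then show ?thesis using \<rho> by simp
    qed
    then have A2: "\<rho> ^ n * (\<tau> * (W * sqrt (g u))) \<le> \<rho> ^ n * ((\<rho> - r) * E u)"
      using \<rho> by (intro mult_left_mono) auto
    have "\<bar>w (Suc n) u\<bar> \<le> r * \<bar>w n u\<bar> + \<tau> * \<bar>A (w n) u\<bar>"
      unfolding wS using r \<tau> abs_triangle_ineq4[of "r * w n u" "\<tau> * A (w n) u"] by (simp add: abs_mult)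
    also have "\<dots> \<le> r * (\<rho> ^ n * E u) + \<rho> ^ n * ((\<rho> - r) * E u)"
      using A1 A2 mult_left_mono[OF Suc r(1)] by (simp add: mult_ac)
    finally show ?case by (simp add: algebra_simps)
  qed
  have geo: "summable (\<lambda>n. \<rho> ^ n)" using \<rho> by (simp add: summable_geometric)
  have wsum_abs: "summable (\<lambda>n. \<bar>w n u\<bar>)" if "u \<in> space M" for u
    using wE[OF that] by (intro summable_comparison_test'[OF summable_mult2[OF geo, of "E u"], of 0]) auto
  have wsum: "summable (\<lambda>n. w n u)" if "u \<in> space M" for u
    using summable_rabs_cancel[OF wsum_abs[OF that]] .
  define f where "f = (\<lambda>u. \<Sum>n. w n u)"
  have fm: "f \<in> borel_measurable M" unfolding f_def by measurable
  have f_le: "\<bar>f u\<bar> \<le> \<bar>(1 / (1 - \<rho>)) * E u\<bar>" if u: "u \<in> space M" for u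
  proof -
    have "\<bar>f u\<bar> \<le> (\<Sum>n. \<bar>w n u\<bar>)" unfolding f_def by (rule summable_rabs[OF wsum_abs[OF u]])
    also have "\<dots> \<le> (\<Sum>n. \<rho> ^ n * E u)"
      by (intro suminf_le wE[OF u] wsum_abs[OF u] summable_mult2 geo)
    also have "\<dots> = (1 / (1 - \<rho>)) * E u"
      using \<rho> by (simp add: suminf_mult2[OF geo, symmetric] suminf_geometric)
    finally show ?thesis by (rule order_trans) (rule abs_ge_self)
  qed
  have fI: "sq_integrable M f"
    by (rule sq_integrable_bound[OF sq_integrable_cmult[OF EI] fm f_le])
  have "c * f u + A f u = b u" if u: "u \<in> space M" for u
  proof -
    \<comment> \<open>Sum and integral may be exchanged: the terms are dominated by
      \<open>\<rho> ^ n\<close> times the integrable function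
      \<open>E s * \<kappa> s u\<close>.\<close>
    have "(\<lambda>n. \<integral>s. w n s * \<kappa> s u \<partial>M) sums (\<integral>s. (\<Sum>n. w n s * \<kappa> s u) \<partial>M)"
    proof (rule sums_integral)
      show "integrable M (\<lambda>s. w n s * \<kappa> s u)" for n by (rule integrable_kernel[OF wI u])
      show "AE s in M. summable (\<lambda>n. norm (w n s * \<kappa> s u))"
        using wsum_abs by (intro AE_I2) (auto simp: abs_mult intro: summable_mult2)
      have Ek: "integrable M (\<lambda>s. E s * \<kappa> s u)" by (rule integrable_kernel[OF EI u])
      have "(\<integral>s. norm (w n s * \<kappa> s u) \<partial>M) \<le> \<rho> ^ n * (\<integral>s. E s * \<kappa> s u \<partial>M)" for n
      proof -
        have "(\<integral>s. norm (w n s * \<kappa> s u) \<partial>M) \<le> (\<integral>s. \<rho> ^ n * (E s * \<kappa> s u) \<partial>M)"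
        proof (rule integral_mono)
          show "integrable M (\<lambda>s. norm (w n s * \<kappa> s u))"
            by (intro integrable_norm integrable_kernel[OF wI u])
          show "integrable M (\<lambda>s. \<rho> ^ n * (E s * \<kappa> s u))" using Ek by simp
          show "norm (w n s * \<kappa> s u) \<le> \<rho> ^ n * (E s * \<kappa> s u)" if "s \<in> space M" for s
            using mult_right_mono[OF wE[OF that, of n] kernel_nonneg[of s u]]
            by (simp add: abs_mult kernel_nonneg mult.assoc)
        qed
        then show ?thesis by simp
      qed
      then show "summable (\<lambda>n. \<integral>s. norm (w n s * \<kappa> s u) \<partial>M)"
        by (intro summable_comparison_test'[OF summable_mult2[OF geo], of 0])
           (auto simp: Bochner_Integration.integral_nonneg)
    qed
    also have "(\<integral>s. (\<Sum>n. w n s * \<kappa> s u) \<partial>M) = A f u"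
      unfolding A_def f_def
      by (intro Bochner_Integration.integral_cong refl suminf_mult2[symmetric] wsum)
    finally have sumA: "(\<lambda>n. A (w n) u) sums A f u" by (simp add: A_def)
    have "(\<lambda>n. c * w n u + A (w n) u) sums (c * f u + A f u)"
      unfolding f_def by (intro sums_add sums_mult summable_sums wsum u) (use sumA f_def in simp)
    \<comment> \<open>The recursion makes the series telescope to
      \<open>w 0 u / \<tau> = b u\<close>.\<close>
    moreover have "c * w n u + A (w n) u = (w n u - w (Suc n) u) / \<tau>" for n
      using \<tau> by (simp add: wS r_def field_simps)
    ultimately have 1: "(\<lambda>n. (w n u - w (Suc n) u) / \<tau>) sums (c * f u + A f u)" by simp
    have "(\<lambda>n. (w n u - w (Suc n) u) / \<tau>) sums ((w 0 u - 0) / \<tau>)"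
      by (intro sums_divide telescope_sums' summable_LIMSEQ_zero wsum u)
    from sums_unique2[OF 1 this] show ?thesis using \<tau> by (simp add: w0)
  qed
  then show ?thesis using that fI by blast
qed

end

section \<open>Singular integrals and differentiation under the integral sign\<close>

lemma integrable_powr_from_0:
  fixes p c :: real
  assumes "p < 1" "0 \<le> c"
  shows "integrable lborel (\<lambda>x. indicator {0<..c} x * x powr - p)" (is ?I)
    and "(\<integral>x. indicator {0<..c} x * x powr - p \<partial>lborel) = c powr (1 - p) / (1 - p)" (is ?V)
proof -
  have "(\<lambda>x. x powr - p) absolutely_integrable_on {0<..c}"
    using assms by (intro nonnegative_absolutely_integrable_1 integrable_on_powr_from_0') auto
  then show I: ?I
    by (simp add: set_integrable_def integrable_completion)
  have *: "{0<..c} - {0..c} = {}" "{0..c} - {0<..c} = {0}" using assms by auto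
  have "((\<lambda>x. x powr - p) has_integral (c powr (- p + 1) / (- p + 1))) {0<..c}"
    using has_integral_powr_from_0[of "- p" c] assms
    by (subst has_integral_spike_set_eq[of _ "{0..c}"]) (simp_all add: * negligible_subset[of "{0}"])
  then have "integral {0<..c} (\<lambda>x. x powr - p) = c powr (1 - p) / (1 - p)"
    by (simp add: integral_unique)
  moreover have "(LINT x : {0<..c} | lborel. x powr - p) = integral {0<..c} (\<lambda>x. x powr - p)"
    by (rule set_borel_integral_eq_integral) (use I in \<open>simp add: set_integrable_def\<close>)
  ultimately show ?V by (simp add: set_lebesgue_integral_def)
qed

text \<open>On either side of \<open>u\<close> the integrand is dominated by a reflected or
  translated copy of the power on \<open>{0<..c}\<close>, whence the factor 2. At
  \<open>x = u\<close> it is 0, because \<open>0 powr y = 0\<close>.\<close>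

lemma integrable_powr_dist:
  fixes q u c :: real
  assumes q: "q < 1" and u: "u \<in> {0..c}"
  shows "integrable lborel (\<lambda>x. indicator {0<..c} x * \<bar>u - x\<bar> powr - q)" (is "integrable _ ?f")
    and "(\<integral>x. indicator {0<..c} x * \<bar>u - x\<bar> powr - q \<partial>lborel) \<le> 2 * c powr (1 - q) / (1 - q)"
proof -
  have c: "0 \<le> c" using u by auto
  define g where "g = (\<lambda>x::real. indicator {0<..c} x * x powr - q)"
  have g: "integrable lborel g" "(\<integral>x. g x \<partial>lborel) = c powr (1 - q) / (1 - q)"
    unfolding g_def by (rule integrable_powr_from_0[OF q c])+
  have gl: "integrable lborel (\<lambda>x. g (u + (-1) * x))"
    by (rule lborel_integrable_real_affine[OF g(1)]) simp
  have gr: "integrable lborel (\<lambda>x. g (- u + 1 * x))"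
    by (rule lborel_integrable_real_affine[OF g(1)]) simp
  have le: "?f x \<le> g (u + (-1) * x) + g (- u + 1 * x)" for x
    using u by (cases x u rule: linorder_cases) (auto simp: g_def indicator_def abs_if)
  show I: "integrable lborel ?f"
    by (rule Bochner_Integration.integrable_bound[OF Bochner_Integration.integrable_add[OF gl gr]])
       (use le in \<open>auto intro!: AE_I2 order_trans[OF _ abs_ge_self]\<close>)
  have "(\<integral>x. ?f x \<partial>lborel) \<le> (\<integral>x. g (u + (-1) * x) + g (- u + 1 * x) \<partial>lborel)"
    by (rule integral_mono[OF I Bochner_Integration.integrable_add[OF gl gr] le])
  also have "\<dots> = (\<integral>x. g x \<partial>lborel) + (\<integral>x. g x \<partial>lborel)"
    using lborel_integral_real_affine[of "-1" g u] lborel_integral_real_affine[of 1 g "-u"]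
    by (subst Bochner_Integration.integral_add[OF gl gr]) simp
  finally show "(\<integral>x. ?f x \<partial>lborel) \<le> 2 * c powr (1 - q) / (1 - q)" by (simp add: g(2))
qed

text \<open>Every \<open>x\<close> has distance at least \<open>u / 2\<close> from one of the two
  singularities 0 and \<open>u\<close>, so one factor can be frozen at \<open>u / 2\<close>.\<close>

lemma powr_mult_powr_dist_le:
  fixes p q u x :: real
  assumes "0 \<le> p" "0 \<le> q" "0 < u" "0 < x"
  shows "x powr - p * \<bar>u - x\<bar> powr - q
    \<le> (u / 2) powr - q * x powr - p + (u / 2) powr - p * \<bar>u - x\<bar> powr - q"
proof (cases "x \<le> u / 2")
  case True
  then have "\<bar>u - x\<bar> powr - q \<le> (u / 2) powr - q"
    using assms by (intro powr_mono2') auto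
  then have "x powr - p * \<bar>u - x\<bar> powr - q \<le> (u / 2) powr - q * x powr - p"
    by (simp add: mult_left_mono mult.commute)
  then show ?thesis by (simp add: add_increasing2)
next
  case False
  then have "x powr - p \<le> (u / 2) powr - p"
    using assms by (intro powr_mono2') auto
  then have "x powr - p * \<bar>u - x\<bar> powr - q \<le> (u / 2) powr - p * \<bar>u - x\<bar> powr - q"
    by (simp add: mult_right_mono)
  then show ?thesis by (simp add: add_increasing)
qed

lemma integrable_powr_mult_powr_dist:
  fixes p q u c :: real
  assumes p: "0 \<le> p" "p < 1" and q: "0 \<le> q" "q < 1" and u: "0 < u" "u \<le> c"
  shows "integrable lborel (\<lambda>x. indicator {0<..c} x * (x powr - p * \<bar>u - x\<bar> powr - q))"
      (is "integrable _ ?f")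
    and "(\<integral>x. indicator {0<..c} x * (x powr - p * \<bar>u - x\<bar> powr - q) \<partial>lborel)
      \<le> (u / 2) powr - q * (c powr (1 - p) / (1 - p)) + (u / 2) powr - p * (2 * c powr (1 - q) / (1 - q))"
proof -
  have uc: "u \<in> {0..c}" "0 \<le> c" using u by auto
  note I1 = integrable_powr_from_0[OF p(2) uc(2)] and I2 = integrable_powr_dist[OF q(2) uc(1)]
  let ?g = "\<lambda>x. (u / 2) powr - q * (indicator {0<..c} x * x powr - p)
      + (u / 2) powr - p * (indicator {0<..c} x * \<bar>u - x\<bar> powr - q)"
  have gI: "integrable lborel ?g" using I1(1) I2(1) by simp
  have le: "?f x \<le> ?g x" for x
    using powr_mult_powr_dist_le[OF p(1) q(1) u(1), of x] by (auto simp: indicator_def)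
  show I: "integrable lborel ?f"
    by (rule Bochner_Integration.integrable_bound[OF gI])
       (use le in \<open>auto intro!: AE_I2 order_trans[OF _ abs_ge_self]\<close>)
  have "(\<integral>x. ?f x \<partial>lborel) \<le> (\<integral>x. ?g x \<partial>lborel)"
    by (rule integral_mono[OF I gI le])
  also have "\<dots> = (u / 2) powr - q * (c powr (1 - p) / (1 - p))
      + (u / 2) powr - p * (\<integral>x. indicator {0<..c} x * \<bar>u - x\<bar> powr - q \<partial>lborel)"
    using I1 I2(1) by simp
  also have "\<dots> \<le> (u / 2) powr - q * (c powr (1 - p) / (1 - p)) + (u / 2) powr - p * (2 * c powr (1 - q) / (1 - q))"
    using I2(2) by (intro add_left_mono mult_left_mono) auto
  finally show "(\<integral>x. ?f x \<partial>lborel)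
      \<le> (u / 2) powr - q * (c powr (1 - p) / (1 - p)) + (u / 2) powr - p * (2 * c powr (1 - q) / (1 - q))" .
qed

text \<open>A crude substitute for the exact Beta integral: for \<open>c = u\<close> both terms of
  the previous bound scale like \<open>u powr (1 - p - q)\<close>.\<close>

lemma integral_powr_mult_powr_dist_le:
  fixes p q u :: real
  assumes p: "0 \<le> p" "p < 1" and q: "0 \<le> q" "q < 1" and u: "0 < u"
  shows "(\<integral>x. indicator {0<..u} x * (x powr - p * \<bar>u - x\<bar> powr - q) \<partial>lborel)
    \<le> (2 powr q / (1 - p) + 2 * 2 powr p / (1 - q)) * u powr (1 - p - q)"
proof -
  have "(u / 2) powr - q * (u powr (1 - p) / (1 - p)) + (u / 2) powr - p * (2 * u powr (1 - q) / (1 - q))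
      = (2 powr q / (1 - p) + 2 * 2 powr p / (1 - q)) * u powr (1 - p - q)"
  proof -
    have half: "(u / 2) powr - q = 2 powr q * u powr - q" "(u / 2) powr - p = 2 powr p * u powr - p"
      using u by (simp_all add: powr_divide powr_minus divide_simps)
    have "(u / 2) powr - q * (u powr (1 - p) / (1 - p)) = 2 powr q / (1 - p) * (u powr - q * u powr (1 - p))"
      "(u / 2) powr - p * (2 * u powr (1 - q) / (1 - q)) = 2 * 2 powr p / (1 - q) * (u powr - p * u powr (1 - q))"
      unfolding half by (simp_all add: mult_ac)
    moreover have "u powr - q * u powr (1 - p) = u powr (1 - p - q)" "u powr - p * u powr (1 - q) = u powr (1 - p - q)"
      by (simp_all add: algebra_simps flip: powr_add)
    ultimately show ?thesis by (simp only: distrib_right)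
  qed
  then show ?thesis
    using integrable_powr_mult_powr_dist(2)[OF p q u order_refl] by simp
qed

section \<open>Differentiation under the integral sign\<close>

text \<open>Dominated convergence for the difference quotients along sequences; the mean value
  inequality on the convex set \<open>I\<close> bounds them by \<open>w\<close>.\<close>

lemma has_real_derivative_integral:
  fixes f f' :: "real \<Rightarrow> 'a \<Rightarrow> real"
  assumes I: "open I" "convex I" "t0 \<in> I"
    and f: "\<And>t. t \<in> I \<Longrightarrow> integrable M (f t)"
    and f': "f' t0 \<in> borel_measurable M"
    and deriv: "\<And>t x. t \<in> I \<Longrightarrow> x \<in> space M \<Longrightarrow> ((\<lambda>t. f t x) has_real_derivative f' t x) (at t)"
    and bound: "\<And>t x. t \<in> I \<Longrightarrow> x \<in> space M \<Longrightarrow> \<bar>f' t x\<bar> \<le> w x"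
    and w: "integrable M w"
  shows "((\<lambda>t. \<integral>x. f t x \<partial>M) has_real_derivative (\<integral>x. f' t0 x \<partial>M)) (at t0)"
proof -
  let ?F = "\<lambda>t. \<integral>x. f t x \<partial>M"
  have "((\<lambda>y. (?F y - ?F t0) / (y - t0)) \<longlongrightarrow> (\<integral>x. f' t0 x \<partial>M)) (at t0)"
    unfolding tendsto_at_iff_sequentially
  proof (intro allI impI)
    fix X :: "nat \<Rightarrow> real" assume X: "\<forall>i. X i \<in> UNIV - {t0}" "X \<longlonglongrightarrow> t0"
    have "eventually (\<lambda>n. X n \<in> I) sequentially"
      using X(2) I by (metis topological_tendstoD)
    then obtain k where k: "\<And>n. n \<ge> k \<Longrightarrow> X n \<in> I" by (auto simp: eventually_sequentially)
    \<comment> \<open>Dropping the first \<open>k\<close> terms keeps the whole sequence inside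
      \<open>I\<close>, where the derivative bound holds.\<close>
    define Y where "Y = (\<lambda>n. X (n + k))"
    have Y: "Y n \<in> I" "Y n \<noteq> t0" for n using k X(1) by (auto simp: Y_def)
    have Ylim: "Y \<longlonglongrightarrow> t0" unfolding Y_def using X(2) by (rule LIMSEQ_ignore_initial_segment)
    have "(\<lambda>n. \<integral>x. (f (Y n) x - f t0 x) / (Y n - t0) \<partial>M) \<longlonglongrightarrow> (\<integral>x. f' t0 x \<partial>M)"
    proof (rule integral_dominated_convergence[where w=w])
      show "(\<lambda>x. (f (Y n) x - f t0 x) / (Y n - t0)) \<in> borel_measurable M" for n
        using f[OF Y(1)[of n]] f[OF I(3)] by simp
      show "AE x in M. (\<lambda>n. (f (Y n) x - f t0 x) / (Y n - t0)) \<longlonglongrightarrow> f' t0 x"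
      proof (rule AE_I2)
        fix x assume "x \<in> space M"
        then have "((\<lambda>y. (f y x - f t0 x) / (y - t0)) \<longlongrightarrow> f' t0 x) (at t0)"
          using deriv[OF I(3)] by (simp add: has_field_derivative_iff)
        then show "(\<lambda>n. (f (Y n) x - f t0 x) / (Y n - t0)) \<longlonglongrightarrow> f' t0 x"
          using Y(2) Ylim by (auto simp: tendsto_at_iff_sequentially o_def)
      qed
      show "AE x in M. norm ((f (Y n) x - f t0 x) / (Y n - t0)) \<le> w x" for n
      proof (rule AE_I2)
        fix x assume x: "x \<in> space M"
        have "norm (f (Y n) x - f t0 x) \<le> w x * norm (Y n - t0)"
          by (rule field_differentiable_bound[OF I(2), where f' = "\<lambda>t. f' t x"])
             (use deriv bound x Y I in \<open>auto intro: has_field_derivative_at_within\<close>)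
        then show "norm ((f (Y n) x - f t0 x) / (Y n - t0)) \<le> w x"
          using Y(2)[of n] by (simp add: field_simps)
      qed
    qed (use f' w in auto)
    moreover have "(\<integral>x. (f (Y n) x - f t0 x) / (Y n - t0) \<partial>M) = (?F (Y n) - ?F t0) / (Y n - t0)" for n
      using f[OF Y(1)[of n]] f[OF I(3)] by (subst integral_divide_zero) simp
    ultimately have "(\<lambda>n. (?F (X (n + k)) - ?F t0) / (X (n + k) - t0)) \<longlonglongrightarrow> (\<integral>x. f' t0 x \<partial>M)"
      unfolding Y_def by (simp only:)
    then show "((\<lambda>y. (?F y - ?F t0) / (y - t0)) \<circ> X) \<longlonglongrightarrow> (\<integral>x. f' t0 x \<partial>M)"
      unfolding o_def by (rule LIMSEQ_offset)
  qed
  then show ?thesis by (simp add: has_field_derivative_iff)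
qed

section \<open>The Molchan kernel\<close>

locale molchan_kernel =
  fixes H1 H2 T :: real
  assumes H: "1/2 < H1" "H1 < H2" "H2 < 1" "H2 - H1 > 1/4" and T: "0 < T"
begin

definition a :: real where "a = H2 - H1"
definition \<delta> :: real where "\<delta> = H2 - 1/2"
text \<open>\<open>1 - a = \<theta> + 1/4\<close>; this \<theta> becomes the exponent of the
  diagonal singularity of the Gram kernel, and \<open>a > 1/4\<close> says exactly that
  \<open>2 * \<theta> < 1\<close>.\<close>

definition \<theta> :: real where "\<theta> = 3/4 - a"

lemma params: "1/4 < a" "a < 1/2" "0 < \<delta>" "\<delta> < 1/2" "1/4 < \<theta>" "\<theta> < 1/2"
  using H by (auto simp: a_def \<delta>_def \<theta>_def)

section \<open>The kernel after substitution and its derivative in time\<close>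

text \<open>The Beta weight that the substitution \<open>u = v + (t - v) * x\<close> leaves in the
  kernel; both exponents exceed -1.\<close>

definition \<phi> :: "real \<Rightarrow> real" where
  "\<phi> x = indicator {0<..<1} x * ((1 - x) powr (1/2 - H1) * x powr (H2 - 3/2))"

definition J :: "real \<Rightarrow> real \<Rightarrow> real" where
  "J t v = (\<integral>x. \<phi> x * (v + (t - v) * x) powr a \<partial>lborel)"

definition J' :: "real \<Rightarrow> real \<Rightarrow> real" where
  "J' t v = (\<integral>x. \<phi> x * (a * (v + (t - v) * x) powr (a - 1) * x) \<partial>lborel)"

definition B :: real where "B = (\<integral>x. \<phi> x \<partial>lborel)"

text \<open>Product rule for \<open>v powr - \<delta> * ((t - v) powr a * J t v)\<close>, which is
  the kernel without its factor \<open>beta_const H2\<close>.\<close>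

definition K' :: "real \<Rightarrow> real \<Rightarrow> real" where
  "K' t v = v powr - \<delta> * (a * (t - v) powr (a - 1) * J t v + (t - v) powr a * J' t v)"

lemma \<phi>_nonneg: "0 \<le> \<phi> x"
  by (simp add: \<phi>_def)

lemma \<phi>_measurable [measurable]: "\<phi> \<in> borel_measurable borel"
  unfolding \<phi>_def by measurable

lemma \<phi>_integrable: "integrable lborel \<phi>"
proof (rule Bochner_Integration.integrable_bound)
  show "integrable lborel (\<lambda>x. indicator {0<..1} x * (x powr - (3/2 - H2) * \<bar>1 - x\<bar> powr - (H1 - 1/2)))"
    using H by (intro integrable_powr_mult_powr_dist) auto
  show "AE x in lborel. norm (\<phi> x)
      \<le> norm (indicator {0<..1} x * (x powr - (3/2 - H2) * \<bar>1 - x\<bar> powr - (H1 - 1/2)))"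
    by (rule AE_I2) (auto simp: \<phi>_def indicator_def)
qed simp

lemma segment_between:
  assumes "0 < v" "v < t" "x \<in> {0<..<1::real}"
  shows "v < v + (t - v) * x" "v + (t - v) * x < t"
proof -
  have "(t - v) * x < (t - v) * 1" using assms by (intro mult_strict_left_mono) auto
  then show "v + (t - v) * x < t" by simp
qed (use assms in auto)

lemma J_integrand:
  assumes "0 < v" "v < t"
  shows "integrable lborel (\<lambda>x. \<phi> x * (v + (t - v) * x) powr a)"
    and "\<phi> x * (v + (t - v) * x) powr a \<le> t powr a * \<phi> x"
proof -
  have le: "\<phi> x * (v + (t - v) * x) powr a \<le> t powr a * \<phi> x" for x
  proof (cases "x \<in> {0<..<1}")
    case True
    then have "(v + (t - v) * x) powr a \<le> t powr a"
      using segment_between[OF assms True] assms params by (intro powr_mono2) auto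
    then show ?thesis using \<phi>_nonneg[of x] by (simp add: mult_left_mono mult.commute)
  qed (simp add: \<phi>_def)
  then show "\<phi> x * (v + (t - v) * x) powr a \<le> t powr a * \<phi> x" .
  show "integrable lborel (\<lambda>x. \<phi> x * (v + (t - v) * x) powr a)"
    by (rule Bochner_Integration.integrable_bound[OF integrable_mult_right[OF \<phi>_integrable, of "t powr a"]])
       (use le in \<open>auto intro!: AE_I2 simp: \<phi>_nonneg abs_mult\<close>)
qed

lemma J_bounds:
  assumes "0 < v" "v < t"
  shows "0 \<le> J t v" "J t v \<le> t powr a * B"
proof -
  show "0 \<le> J t v"
    unfolding J_def by (intro Bochner_Integration.integral_nonneg) (simp add: \<phi>_nonneg)
  have "J t v \<le> (\<integral>x. t powr a * \<phi> x \<partial>lborel)"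
    unfolding J_def using \<phi>_integrable by (intro integral_mono J_integrand[OF assms]) auto
  then show "J t v \<le> t powr a * B" by (simp add: B_def)
qed

text \<open>The bound does not depend on \<open>t\<close>, so it can dominate when \<open>J\<close>
  is differentiated under the integral sign.\<close>

lemma J'_integrand_bound:
  assumes "0 < v" "v < t"
  shows "\<bar>\<phi> x * (a * (v + (t - v) * x) powr (a - 1) * x)\<bar> \<le> a * v powr (a - 1) * \<phi> x"
proof (cases "x \<in> {0<..<1}")
  case True
  have "(v + (t - v) * x) powr (a - 1) \<le> v powr (a - 1)"
    using segment_between[OF assms True] assms params by (intro powr_mono2') auto
  then have "(v + (t - v) * x) powr (a - 1) * x \<le> v powr (a - 1) * 1"
    using True by (intro mult_mono) auto
  then have "(\<phi> x * a) * ((v + (t - v) * x) powr (a - 1) * x) \<le> (\<phi> x * a) * v powr (a - 1)"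
    using params \<phi>_nonneg[of x] by (intro mult_left_mono) auto
  then show ?thesis
    using True params \<phi>_nonneg[of x] by (simp add: abs_mult mult_ac)
qed (simp add: \<phi>_def)

lemma J'_integrable:
  assumes "0 < v" "v < t"
  shows "integrable lborel (\<lambda>x. \<phi> x * (a * (v + (t - v) * x) powr (a - 1) * x))"
  by (rule Bochner_Integration.integrable_bound
        [OF integrable_mult_right[OF \<phi>_integrable, of "a * v powr (a - 1)"]])
     (use J'_integrand_bound[OF assms] in \<open>auto intro!: AE_I2 order_trans[OF _ abs_ge_self]\<close>)

text \<open>The second bound does not blow up as \<open>v\<close> tends to 0: with
  \<open>y = v + (t - v) * x\<close> one has \<open>(t - v) * x \<le> y\<close>, so the factor
  \<open>t - v\<close> absorbs the negative power of \<open>y\<close>.\<close>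

lemma J'_bounds:
  assumes "0 < v" "v < t"
  shows "0 \<le> J' t v" "(t - v) * J' t v \<le> a * (t powr a * B)"
proof -
  have nn: "0 \<le> \<phi> x * (a * (v + (t - v) * x) powr (a - 1) * x)" for x
    using params by (cases "x \<in> {0<..<1}") (auto simp: \<phi>_nonneg \<phi>_def)
  show "0 \<le> J' t v"
    unfolding J'_def by (intro Bochner_Integration.integral_nonneg nn)
  have "(t - v) * J' t v = (\<integral>x. (t - v) * (\<phi> x * (a * (v + (t - v) * x) powr (a - 1) * x)) \<partial>lborel)"
    unfolding J'_def by simp
  also have "\<dots> \<le> (\<integral>x. a * (\<phi> x * (v + (t - v) * x) powr a) \<partial>lborel)"
  proof (rule integral_mono)
    fix x
    show "(t - v) * (\<phi> x * (a * (v + (t - v) * x) powr (a - 1) * x))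
        \<le> a * (\<phi> x * (v + (t - v) * x) powr a)"
    proof (cases "x \<in> {0<..<1}")
      case True
      let ?y = "v + (t - v) * x"
      have y: "0 < ?y" using segment_between[OF assms True] assms by simp
      have "?y powr (a - 1) * ((t - v) * x) \<le> ?y powr (a - 1) * ?y"
        using assms by (intro mult_left_mono) auto
      also have "\<dots> = ?y powr a"
        using y powr_mult_base[of ?y "a - 1"] by (simp add: mult.commute)
      finally have "(a * \<phi> x) * (?y powr (a - 1) * ((t - v) * x)) \<le> (a * \<phi> x) * ?y powr a"
        using params \<phi>_nonneg[of x] by (intro mult_left_mono) auto
      then show ?thesis by (simp add: mult_ac)
    qed (simp add: \<phi>_def)
  qed (use J_integrand[OF assms] J'_integrable[OF assms] in auto)
  also have "\<dots> = a * J t v" by (simp add: J_def)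
  also have "\<dots> \<le> a * (t powr a * B)"
    using J_bounds(2)[OF assms] params by (intro mult_left_mono) auto
  finally show "(t - v) * J' t v \<le> a * (t powr a * B)" .
qed

lemma B_nonneg: "0 \<le> B"
  unfolding B_def by (intro Bochner_Integration.integral_nonneg \<phi>_nonneg)

text \<open>After factoring out \<open>(t - v) powr (a - 1)\<close>, each of the two terms is at
  most \<open>a * (t powr a * B)\<close>.\<close>

lemma K'_bounds:
  assumes "0 < v" "v < t"
  shows "0 \<le> K' t v" "K' t v \<le> 2 * a * B * (t powr a * (v powr - \<delta> * (t - v) powr (a - 1)))"
proof -
  show "0 \<le> K' t v"
    unfolding K'_def using J_bounds[OF assms] J'_bounds[OF assms] params by simp
  have 1: "a * (t - v) powr (a - 1) * J t v \<le> a * (t - v) powr (a - 1) * (t powr a * B)"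
    using J_bounds(2)[OF assms] params by (intro mult_left_mono) auto
  have "(t - v) powr a * J' t v = (t - v) powr (a - 1) * ((t - v) * J' t v)"
    using assms powr_mult_base[of "t - v" "a - 1"] by (simp add: mult_ac)
  also have "\<dots> \<le> (t - v) powr (a - 1) * (a * (t powr a * B))"
    using J'_bounds(2)[OF assms] by (intro mult_left_mono) auto
  finally have "a * (t - v) powr (a - 1) * J t v + (t - v) powr a * J' t v
      \<le> 2 * a * B * (t powr a * (t - v) powr (a - 1))"
    using 1 by (simp add: mult_ac)
  then have "K' t v \<le> v powr - \<delta> * (2 * a * B * (t powr a * (t - v) powr (a - 1)))"
    unfolding K'_def by (intro mult_left_mono) auto
  then show "K' t v \<le> 2 * a * B * (t powr a * (v powr - \<delta> * (t - v) powr (a - 1)))"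
    by (simp add: mult_ac)
qed

lemma J_deriv:
  assumes "0 < v" "v < t"
  shows "((\<lambda>t. J t v) has_real_derivative J' t v) (at t)"
  unfolding J_def J'_def
proof (rule has_real_derivative_integral[where I = "{v<..}" and w = "\<lambda>x. a * v powr (a - 1) * \<phi> x"
      and f' = "\<lambda>t x. \<phi> x * (a * (v + (t - v) * x) powr (a - 1) * x)"])
  show "integrable lborel (\<lambda>x. \<phi> x * (v + (s - v) * x) powr a)" if "s \<in> {v<..}" for s
    using J_integrand(1)[of v s] assms that by simp
  show "\<bar>\<phi> x * (a * (v + (s - v) * x) powr (a - 1) * x)\<bar> \<le> a * v powr (a - 1) * \<phi> x"
    if "s \<in> {v<..}" for s x
    using J'_integrand_bound[of v s] assms that by simp
  show "((\<lambda>t. \<phi> x * (v + (t - v) * x) powr a) has_real_derivative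
      \<phi> x * (a * (v + (s - v) * x) powr (a - 1) * x)) (at s)" if "s \<in> {v<..}" for s x
  proof (cases "x \<in> {0<..<1}")
    case True
    have "v < v + (s - v) * x" using segment_between(1)[of v s x] assms that True by simp
    then have "0 < v + (s - v) * x" using assms by linarith
    then show ?thesis by (auto intro!: derivative_eq_intros simp: powr_diff)
  qed (simp add: \<phi>_def)
qed (use assms \<phi>_integrable in auto)

text \<open>The substitution \<open>u = v + (t - v) x\<close> removes the dependence of the singularities on \<open>t\<close>.\<close>

lemma Kker_eq:
  assumes "0 < v" "v < t"
  shows "Kker H1 H2 t v = beta_const H2 * (v powr - \<delta> * ((t - v) powr a * J t v))"
proof -
  let ?f = "\<lambda>u. indicator {v<..<t} u * ((t - u) powr (1/2 - H1) * u powr (H2 - H1) * (u - v) powr (H2 - 3/2))"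
  have eq: "(t - v) * ?f (v + (t - v) * x) = (t - v) powr a * (\<phi> x * (v + (t - v) * x) powr a)" for x
  proof -
    have ind: "indicator {v<..<t} (v + (t - v) * x) = (indicator {0<..<1} x :: real)"
    proof -
      have "0 < (t - v) * x \<longleftrightarrow> 0 < x" "(t - v) * x < t - v \<longleftrightarrow> x < 1"
        using assms by (simp_all add: zero_less_mult_iff mult_less_cancel_left2)
      then have "v < v + (t - v) * x \<longleftrightarrow> 0 < x" "v + (t - v) * x < t \<longleftrightarrow> x < 1" by linarith+
      then show ?thesis by (simp add: indicator_def)
    qed
    have "t - (v + (t - v) * x) = (t - v) * (1 - x)" by (simp add: algebra_simps)
    moreover have "v + (t - v) * x - v = (t - v) * x" by simp
    \<comment> \<open>The Jacobian adds 1 to the exponents \<open>1/2 - H1\<close> and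
      \<open>H2 - 3/2\<close>, and the total is \<open>a\<close>.\<close>
    moreover have "(t - v) * ((t - v) powr (1/2 - H1) * (t - v) powr (H2 - 3/2)) = (t - v) powr a"
      using assms powr_mult_base[of "t - v" "(1/2 - H1) + (H2 - 3/2)"]
      by (simp add: a_def flip: powr_add)
    ultimately show ?thesis
      unfolding ind by (simp add: powr_mult \<phi>_def a_def mult_ac)
  qed
  have "(LBINT u:{v<..<t}. (t - u) powr (1/2 - H1) * u powr (H2 - H1) * (u - v) powr (H2 - 3/2))
      = (t - v) * (\<integral>x. ?f (v + (t - v) * x) \<partial>lborel)"
    using lborel_integral_real_affine[of "t - v" ?f v] assms by (simp add: set_lebesgue_integral_def)
  also have "\<dots> = (\<integral>x. (t - v) * ?f (v + (t - v) * x) \<partial>lborel)" by simp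
  also have "\<dots> = (t - v) powr a * J t v" unfolding eq J_def by simp
  finally show ?thesis using assms by (simp add: Kker_def \<delta>_def)
qed

lemma deriv_Kker:
  assumes "0 < v" "v < t"
  shows "deriv (\<lambda>t. Kker H1 H2 t v) t = beta_const H2 * K' t v"
proof (rule DERIV_imp_deriv)
  have "((\<lambda>t. beta_const H2 * (v powr - \<delta> * ((t - v) powr a * J t v)))
      has_real_derivative beta_const H2 * K' t v) (at t)"
    unfolding K'_def using assms
    by (auto intro!: derivative_eq_intros J_deriv simp: powr_diff)
  \<comment> \<open>The closed form is available only for \<open>t > v\<close>, but this set is
    open.\<close>
  then show "((\<lambda>t. Kker H1 H2 t v) has_real_derivative beta_const H2 * K' t v) (at t)"
    by (rule has_field_derivative_transform_within_open[where S = "{v<..}"])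
       (use assms Kker_eq in auto)
qed

section \<open>The Gram factor and pointwise bounds for the kernel\<close>

text \<open>Cutting off outside \<open>{0<..T}\<close> lets the operator act on the whole line. The
  absolute value makes \<open>D\<close> nonnegative without any discussion of the sign of
  \<open>beta_const H2\<close>; only its square enters \<kappa>.\<close>

definition D :: "real \<Rightarrow> real \<Rightarrow> real" where
  "D s v = (if 0 < v \<and> v < s \<and> s \<le> T then \<bar>beta_const H2\<bar> * s powr (H1 - 1/2) * K' s v else 0)"

lemma D_measurable [measurable]: "case_prod D \<in> borel_measurable (lborel \<Otimes>\<^sub>M lborel)"
  unfolding D_def K'_def J_def J'_def by measurable

lemma D_nonneg: "0 \<le> D s v"
  using K'_bounds by (simp add: D_def)

definition C :: real where "C = \<bar>beta_const H2\<bar> * (2 * a * B)"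

lemma C_nonneg: "0 \<le> C"
  using params B_nonneg by (simp add: C_def)

lemma D_bound:
  assumes "0 < v" "v < s"
  shows "D s v \<le> C * (s powr \<delta> * (v powr - \<delta> * (s - v) powr (a - 1)))"
proof (cases "s \<le> T")
  case True
  have "D s v = \<bar>beta_const H2\<bar> * s powr (H1 - 1/2) * K' s v"
    using assms True by (simp add: D_def)
  also have "\<dots> \<le> \<bar>beta_const H2\<bar> * s powr (H1 - 1/2)
      * (2 * a * B * (s powr a * (v powr - \<delta> * (s - v) powr (a - 1))))"
    using K'_bounds[OF assms] by (intro mult_left_mono) auto
  also have "\<dots> = C * ((s powr (H1 - 1/2) * s powr a) * (v powr - \<delta> * (s - v) powr (a - 1)))"
    by (simp add: C_def mult_ac)
  also have "s powr (H1 - 1/2) * s powr a = s powr \<delta>"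
    by (simp add: a_def \<delta>_def flip: powr_add)
  finally show ?thesis .
qed (simp add: D_def C_nonneg)

text \<open>Writing \<open>(u - v) powr (a - 1) = (u - v) powr - \<theta> * (u - v) powr - (1/4)\<close> and estimating the
  first factor at \<open>v = s\<close> leaves the exponent \<open>a - 5/4 > - 1\<close> at the singularity \<open>v = s\<close>, while
  \<open>2 * \<theta> < 1\<close> makes the remaining factor square integrable; both need \<open>a > 1/4\<close>.\<close>

lemma D_mult_bound:
  assumes su: "0 < s" "s < u" "u \<le> T"
  shows "D s v * D u v \<le> C\<^sup>2 * T powr \<delta> * s powr \<delta> * (u - s) powr - \<theta>
    * (indicator {0<..s} v * (v powr - (2 * \<delta>) * \<bar>s - v\<bar> powr - (5/4 - a)))"
proof (cases "0 < v \<and> v < s")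
  case True
  then have v: "0 < v" "v < s" "v < u" using su by auto
  have "(u - v) powr (a - 1) = (u - v) powr - \<theta> * (u - v) powr - (1/4)"
    by (simp add: \<theta>_def flip: powr_add)
  \<comment> \<open>\<open>u - v\<close> exceeds both \<open>u - s\<close> and \<open>s - v\<close>,
    and negative powers decrease.\<close>
  also have "\<dots> \<le> (u - s) powr - \<theta> * (s - v) powr - (1/4)"
    using v su params by (intro mult_mono powr_mono2') auto
  finally have 1: "(u - v) powr (a - 1) \<le> (u - s) powr - \<theta> * (s - v) powr - (1/4)" .
  have 2: "u powr \<delta> \<le> T powr \<delta>" using su params by (intro powr_mono2) auto
  have "D u v \<le> C * (u powr \<delta> * (v powr - \<delta> * (u - v) powr (a - 1)))"
    by (rule D_bound[OF v(1,3)])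
  also have "\<dots> \<le> C * (T powr \<delta> * (v powr - \<delta> * ((u - s) powr - \<theta> * (s - v) powr - (1/4))))"
    using C_nonneg by (intro mult_left_mono mult_mono 1 2) auto
  finally have Du: "D u v \<le> C * (T powr \<delta> * (v powr - \<delta> * ((u - s) powr - \<theta> * (s - v) powr - (1/4))))" .
  have "D s v * D u v \<le> C * (s powr \<delta> * (v powr - \<delta> * (s - v) powr (a - 1)))
      * (C * (T powr \<delta> * (v powr - \<delta> * ((u - s) powr - \<theta> * (s - v) powr - (1/4)))))"
    by (intro mult_mono D_bound[OF v(1,2)] Du) (auto simp: D_nonneg C_nonneg)
  also have "\<dots> = C\<^sup>2 * T powr \<delta> * s powr \<delta> * (u - s) powr - \<theta>
      * ((v powr - \<delta> * v powr - \<delta>) * ((s - v) powr (a - 1) * (s - v) powr - (1/4)))"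
    by (simp add: power2_eq_square mult_ac)
  also have "v powr - \<delta> * v powr - \<delta> = v powr - (2 * \<delta>)"
    by (simp flip: powr_add)
  also have "(s - v) powr (a - 1) * (s - v) powr - (1/4) = \<bar>s - v\<bar> powr - (5/4 - a)"
    using v by (simp flip: powr_add)
  finally show ?thesis using v by simp
qed (auto simp: D_def C_nonneg)

definition \<kappa> :: "real \<Rightarrow> real \<Rightarrow> real" where
  "\<kappa> s u = (\<integral>v. D s v * D u v \<partial>lborel)"

lemma \<kappa>_commute: "\<kappa> s u = \<kappa> u s"
  by (simp add: \<kappa>_def mult.commute)

lemma \<kappa>_nonneg: "0 \<le> \<kappa> s u"
  unfolding \<kappa>_def by (intro Bochner_Integration.integral_nonneg) (simp add: D_nonneg)

lemma \<kappa>_measurable [measurable]: "(\<lambda>(s, u). \<kappa> s u) \<in> borel_measurable (lborel \<Otimes>\<^sub>M lborel)"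
  unfolding \<kappa>_def by measurable

lemma \<kappa>_outside: "s \<notin> {0<..T} \<or> u \<notin> {0<..T} \<Longrightarrow> \<kappa> s u = 0"
proof -
  assume "s \<notin> {0<..T} \<or> u \<notin> {0<..T}"
  then have "(\<lambda>v. D s v * D u v) = (\<lambda>_. 0)" by (auto simp: D_def)
  then show ?thesis by (simp add: \<kappa>_def)
qed

definition C' :: real where
  "C' = C\<^sup>2 * T powr \<delta> * (2 powr (5/4 - a) / (1 - 2 * \<delta>) + 2 * 2 powr (2 * \<delta>) / (1 - (5/4 - a))) * T powr (a - 1/4)"

text \<open>Integrate \<open>D_mult_bound\<close> over \<open>v\<close>; the exponents
  \<open>2 * \<delta>\<close> and \<open>5/4 - a\<close> are both below 1.\<close>

lemma D_mult_integrable_less: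
  assumes su: "0 < s" "s < u" "u \<le> T"
  shows "integrable lborel (\<lambda>v. D s v * D u v)"
    and "\<kappa> s u \<le> C' * ((u - s) powr - \<theta> * s powr - \<delta>)"
proof -
  let ?h = "\<lambda>v. indicator {0<..s} v * (v powr - (2 * \<delta>) * \<bar>s - v\<bar> powr - (5/4 - a))"
  let ?c = "C\<^sup>2 * T powr \<delta> * s powr \<delta> * (u - s) powr - \<theta>"
  let ?k = "2 powr (5/4 - a) / (1 - 2 * \<delta>) + 2 * 2 powr (2 * \<delta>) / (1 - (5/4 - a))"
  have h: "integrable lborel ?h"
    using params su by (intro integrable_powr_mult_powr_dist) auto
  have h_le: "(\<integral>v. ?h v \<partial>lborel) \<le> ?k * s powr (1 - 2 * \<delta> - (5/4 - a))"
    using params su by (intro integral_powr_mult_powr_dist_le) auto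
  have le: "D s v * D u v \<le> ?c * ?h v" for v
    by (rule D_mult_bound[OF su])
  have c0: "0 \<le> ?c" by simp
  show I: "integrable lborel (\<lambda>v. D s v * D u v)"
    by (rule Bochner_Integration.integrable_bound[OF integrable_mult_right[OF h, of ?c]])
       (use le in \<open>auto intro!: AE_I2 order_trans[OF _ abs_ge_self] simp: D_nonneg\<close>)
  have "\<kappa> s u \<le> (\<integral>v. ?c * ?h v \<partial>lborel)"
    unfolding \<kappa>_def using h by (intro integral_mono[OF I _ le]) simp
  also have "\<dots> = ?c * (\<integral>v. ?h v \<partial>lborel)" by simp
  also have "\<dots> \<le> ?c * (?k * s powr (1 - 2 * \<delta> - (5/4 - a)))"
    by (rule mult_left_mono[OF h_le c0])
  also have "\<dots> = C\<^sup>2 * T powr \<delta> * ?k * (u - s) powr - \<theta> * (s powr \<delta> * s powr (1 - 2 * \<delta> - (5/4 - a)))"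
    by (simp add: mult_ac)
  \<comment> \<open>The positive power \<open>a - 1/4\<close> is split off so that it can be bounded
    by its value at \<open>T\<close>.\<close>
  also have "s powr \<delta> * s powr (1 - 2 * \<delta> - (5/4 - a)) = s powr (a - 1/4) * s powr - \<delta>"
    by (simp flip: powr_add)
  also have "C\<^sup>2 * T powr \<delta> * ?k * (u - s) powr - \<theta> * (s powr (a - 1/4) * s powr - \<delta>)
      \<le> C\<^sup>2 * T powr \<delta> * ?k * (u - s) powr - \<theta> * (T powr (a - 1/4) * s powr - \<delta>)"
    using su params by (intro mult_left_mono mult_right_mono powr_mono2 mult_nonneg_nonneg add_nonneg_nonneg) auto
  also have "\<dots> = C' * ((u - s) powr - \<theta> * s powr - \<delta>)"
    by (simp add: C'_def mult_ac)
  finally show "\<kappa> s u \<le> C' * ((u - s) powr - \<theta> * s powr - \<delta>)" .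
qed

lemma D_mult_integrable:
  assumes "s \<noteq> u"
  shows "integrable lborel (\<lambda>v. D s v * D u v)"
proof (cases "s \<in> {0<..T} \<and> u \<in> {0<..T}")
  case True
  then show ?thesis
    using assms D_mult_integrable_less(1)[of s u] D_mult_integrable_less(1)[of u s]
    by (cases s u rule: linorder_cases) (auto simp: mult.commute)
next
  case False
  then have "(\<lambda>v. D s v * D u v) = (\<lambda>_. 0)" by (auto simp: D_def)
  then show ?thesis by simp
qed

text \<open>The estimate for \<open>s < u\<close> involves a power of the smaller point; adding the
  two versions covers both orders.\<close>

lemma \<kappa>_square_bound:
  assumes "s \<noteq> u" "s \<in> {0<..T}" "u \<in> {0<..T}"
  shows "(\<kappa> s u)\<^sup>2 \<le> C'\<^sup>2 * (s powr - (2 * \<delta>) * \<bar>u - s\<bar> powr - (2 * \<theta>)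
    + u powr - (2 * \<delta>) * \<bar>u - s\<bar> powr - (2 * \<theta>))"
proof -
  have *: "(\<kappa> s u)\<^sup>2 \<le> C'\<^sup>2 * (s powr - (2 * \<delta>) * \<bar>u - s\<bar> powr - (2 * \<theta>))"
    if "0 < s" "s < u" "u \<le> T" for s u
  proof -
    have "(\<kappa> s u)\<^sup>2 \<le> (C' * ((u - s) powr - \<theta> * s powr - \<delta>))\<^sup>2"
      by (intro power_mono D_mult_integrable_less(2)[OF that] \<kappa>_nonneg)
    also have "\<dots> = C'\<^sup>2 * (s powr - (2 * \<delta>) * \<bar>u - s\<bar> powr - (2 * \<theta>))"
    proof -
      have "(x powr - y)\<^sup>2 = x powr - (2 * y)" for x y :: real
        by (simp add: power2_eq_square flip: powr_add)
      then show ?thesis using that by (simp add: power_mult_distrib)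
    qed
    finally show ?thesis .
  qed
  consider "s < u" | "u < s" using assms(1) by linarith
  then show ?thesis
  proof cases
    case 1
    with *[of s u] assms(2,3) show ?thesis
      by (auto elim!: order_trans intro!: mult_left_mono)
  next
    case 2
    with *[of u s] assms(2,3) show ?thesis
      unfolding \<kappa>_commute[of s u] abs_minus_commute[of u s]
      by (auto elim!: order_trans intro!: mult_left_mono)
  qed
qed

section \<open>Square integrability and the Hilbert-Schmidt property\<close>

text \<open>\<open>c1\<close> is the integral of \<open>s powr - (2 * \<delta>)\<close> over
  \<open>{0<..T}\<close>, and \<open>c2\<close> bounds that of
  \<open>\<bar>u - s\<bar> powr - (2 * \<theta>)\<close> uniformly in \<open>u\<close>.\<close>

definition c1 :: real where "c1 = T powr (1 - 2 * \<delta>) / (1 - 2 * \<delta>)"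
definition c2 :: real where "c2 = 2 * T powr (1 - 2 * \<theta>) / (1 - 2 * \<theta>)"

lemma \<kappa>_square_integrable_inside:
  assumes u: "u \<in> {0<..T}"
  shows "integrable lborel (\<lambda>s. (\<kappa> s u)\<^sup>2)"
    and "(\<integral>s. (\<kappa> s u)\<^sup>2 \<partial>lborel)
      \<le> C'\<^sup>2 * ((u / 2) powr - (2 * \<theta>) * c1 + (u / 2) powr - (2 * \<delta>) * c2 + u powr - (2 * \<delta>) * c2)"
proof -
  have u': "0 < u" "u \<le> T" "u \<in> {0..T}" using u by auto
  let ?f1 = "\<lambda>s. indicator {0<..T} s * (s powr - (2 * \<delta>) * \<bar>u - s\<bar> powr - (2 * \<theta>))"
  let ?f2 = "\<lambda>s. indicator {0<..T} s * \<bar>u - s\<bar> powr - (2 * \<theta>)"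
  let ?g = "\<lambda>s. C'\<^sup>2 * (?f1 s + u powr - (2 * \<delta>) * ?f2 s)"
  have f1: "integrable lborel ?f1"
      "(\<integral>s. ?f1 s \<partial>lborel) \<le> (u / 2) powr - (2 * \<theta>) * c1 + (u / 2) powr - (2 * \<delta>) * c2"
    unfolding c1_def c2_def by (rule integrable_powr_mult_powr_dist; use params u' in simp)+
  have f2: "integrable lborel ?f2" "(\<integral>s. ?f2 s \<partial>lborel) \<le> c2"
    unfolding c2_def by (rule integrable_powr_dist; use params u' in simp)+
  have g: "integrable lborel ?g" using f1(1) f2(1) by simp
  \<comment> \<open>The diagonal point \<open>s = u\<close>, where no bound was derived, is a null
    set.\<close>
  have le: "AE s in lborel. (\<kappa> s u)\<^sup>2 \<le> ?g s"
    using AE_lborel_singleton[of u]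
  proof eventually_elim
    case (elim s)
    then show ?case
      using \<kappa>_square_bound[of s u] u \<kappa>_outside[of s u]
      by (cases "s \<in> {0<..T}") (auto simp: distrib_left mult.assoc)
  qed
  have m: "(\<lambda>s. (\<kappa> s u)\<^sup>2) \<in> borel_measurable lborel" by measurable
  show I: "integrable lborel (\<lambda>s. (\<kappa> s u)\<^sup>2)"
    by (rule Bochner_Integration.integrable_bound[OF g m])
       (use le in eventually_elim, auto intro: order_trans[OF _ abs_ge_self])
  have "(\<integral>s. (\<kappa> s u)\<^sup>2 \<partial>lborel) \<le> (\<integral>s. ?g s \<partial>lborel)"
    by (rule integral_mono_AE[OF I g le])
  also have "\<dots> = C'\<^sup>2 * ((\<integral>s. ?f1 s \<partial>lborel) + u powr - (2 * \<delta>) * (\<integral>s. ?f2 s \<partial>lborel))"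
    using f1(1) f2(1) by simp
  also have "\<dots> \<le> C'\<^sup>2 * ((u / 2) powr - (2 * \<theta>) * c1 + (u / 2) powr - (2 * \<delta>) * c2 + u powr - (2 * \<delta>) * c2)"
    using f1(2) f2(2) by (intro mult_left_mono add_mono) auto
  finally show "(\<integral>s. (\<kappa> s u)\<^sup>2 \<partial>lborel)
      \<le> C'\<^sup>2 * ((u / 2) powr - (2 * \<theta>) * c1 + (u / 2) powr - (2 * \<delta>) * c2 + u powr - (2 * \<delta>) * c2)" .
qed

lemma \<kappa>_square_integrable: "integrable lborel (\<lambda>s. (\<kappa> s u)\<^sup>2)"
  by (cases "u \<in> {0<..T}") (simp_all add: \<kappa>_square_integrable_inside \<kappa>_outside)

text \<open>The bounds for the sections are combinations of \<open>u powr - (2 * \<theta>)\<close>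
  and \<open>u powr - (2 * \<delta>)\<close>, again integrable on \<open>{0<..T}\<close>.\<close>

lemma \<kappa>_Hilbert_Schmidt: "integrable lborel (\<lambda>u. \<integral>s. (\<kappa> s u)\<^sup>2 \<partial>lborel)"
proof (rule Bochner_Integration.integrable_bound)
  let ?g = "\<lambda>u. C'\<^sup>2 * (2 powr (2 * \<theta>) * c1 * (indicator {0<..T} u * u powr - (2 * \<theta>))
      + (2 powr (2 * \<delta>) + 1) * c2 * (indicator {0<..T} u * u powr - (2 * \<delta>)))"
  have "integrable lborel (\<lambda>u. indicator {0<..T} u * u powr - (2 * \<theta>))"
    and "integrable lborel (\<lambda>u. indicator {0<..T} u * u powr - (2 * \<delta>))"
    using params T by (intro integrable_powr_from_0(1); simp)+
  then show "integrable lborel ?g" by simp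
  show "(\<lambda>u. \<integral>s. (\<kappa> s u)\<^sup>2 \<partial>lborel) \<in> borel_measurable lborel" by measurable
  show "AE u in lborel. norm (\<integral>s. (\<kappa> s u)\<^sup>2 \<partial>lborel) \<le> norm (?g u)"
  proof (rule AE_I2)
    fix u :: real
    show "norm (\<integral>s. (\<kappa> s u)\<^sup>2 \<partial>lborel) \<le> norm (?g u)"
    proof (cases "u \<in> {0<..T}")
      case True
      have "(u / 2) powr - x = 2 powr x * u powr - x" for x
        using True by (simp add: powr_divide powr_minus divide_simps)
      then have "(\<integral>s. (\<kappa> s u)\<^sup>2 \<partial>lborel) \<le> ?g u"
        using \<kappa>_square_integrable_inside(2)[OF True] True by (simp add: algebra_simps)
      then show ?thesis by simp
    qed (simp add: \<kappa>_outside)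
  qed
qed

lemma gram_kernel_D: "gram_kernel lborel lborel D \<kappa>"
proof
  show "AE s in lborel. integrable lborel (\<lambda>v. D s v * D u v)" for u
    using AE_lborel_singleton[of u] by eventually_elim (rule D_mult_integrable)
qed (use D_nonneg \<kappa>_square_integrable \<kappa>_Hilbert_Schmidt D_measurable in \<open>simp_all add: \<kappa>_def\<close>)

section \<open>Translation to the original equation\<close>

text \<open>The supports of \<open>D s\<close> and \<open>D u\<close> meet in
  \<open>{0<..<min s u}\<close>, and the absolute values of \<open>beta_const H2\<close> multiply to
  its square.\<close>

lemma \<kappa>_eq_kker:
  assumes "s \<in> {0<..T}" "u \<in> {0<..T}"
  shows "\<kappa> s u = s powr (H1 - 1/2) * u powr (H1 - 1/2) * kker H1 H2 s u"
proof -
  have "D s v * D u v = s powr (H1 - 1/2) * u powr (H1 - 1/2) * (indicator {0<..<min s u} v *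
      (deriv (\<lambda>t. Kker H1 H2 t v) s * deriv (\<lambda>t. Kker H1 H2 t v) u))" for v
    using assms by (auto simp: D_def deriv_Kker indicator_def abs_mult_self_eq mult_ac simp flip: abs_mult)
  then show ?thesis
    unfolding \<kappa>_def kker_def set_lebesgue_integral_def by simp
qed

definition weighted :: "(real \<Rightarrow> real) \<Rightarrow> real \<Rightarrow> real" where
  "weighted h u = indicator {0<..T} u * (h u * u powr (1/2 - H1))"

text \<open>The intervals \<open>{0..T}\<close> and \<open>{0<..T}\<close> give identical functions
  here, since \<open>0 powr (1/2 - H1) = 0\<close>.\<close>

lemma admissible_iff: "admissible H1 T h \<longleftrightarrow> sq_integrable lborel (weighted h)"
proof -
  have "(\<lambda>u. indicator {0..T} u *\<^sub>R (h u * u powr (1/2 - H1))) = weighted h"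
    and "(\<lambda>u. indicator {0..T} u *\<^sub>R (h u * u powr (1/2 - H1))\<^sup>2) = (\<lambda>u. (weighted h u)\<^sup>2)"
    by (auto simp: weighted_def indicator_def less_le)
  then show ?thesis
    unfolding admissible_def set_borel_measurable_def set_integrable_def sq_integrable_def by simp
qed

text \<open>On \<open>{0<..T}\<close> the original equation is the new one times
  \<open>u powr (1/2 - H1)\<close>, which is not 0, and the integrability clause holds by
  Cauchy-Schwarz. Outside, every term vanishes.\<close>

lemma solves_eq_iff:
  assumes "sq_integrable lborel (weighted h)"
  shows "solves_eq H1 H2 \<gamma> T h \<longleftrightarrow> (\<forall>u.
    \<gamma>\<^sup>2 * weighted h u + (\<integral>s. weighted h s * \<kappa> s u \<partial>lborel) = \<gamma>\<^sup>2 * weighted (\<lambda>_. 1) u)"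
proof -
  have pw: "x powr (1/2 - H1) * x powr (H1 - 1/2) = 1" if "0 < x" for x :: real
    using that by (simp flip: powr_add)
  have sq: "x powr (1 - 2 * H1) = x powr (1/2 - H1) * x powr (1/2 - H1)" for x :: real
    by (simp flip: powr_add)
  have "(set_integrable lborel {0<..T} (\<lambda>s. h s * kker H1 H2 s u) \<and>
        \<gamma>\<^sup>2 * u powr (1 - 2 * H1) =
          \<gamma>\<^sup>2 * h u * u powr (1 - 2 * H1) + (LBINT s:{0<..T}. h s * kker H1 H2 s u))
      \<longleftrightarrow> \<gamma>\<^sup>2 * weighted h u + (\<integral>s. weighted h s * \<kappa> s u \<partial>lborel) = \<gamma>\<^sup>2 * weighted (\<lambda>_. 1) u"
    if u: "u \<in> {0<..T}" for u
  proof -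
    define z where "z = u powr (1/2 - H1)"
    have z: "z \<noteq> 0" using u by (simp add: z_def)
    have eq: "indicator {0<..T} s *\<^sub>R (h s * kker H1 H2 s u) = z * (weighted h s * \<kappa> s u)" for s
    proof (cases "s \<in> {0<..T}")
      case True
      have "z * (weighted h s * \<kappa> s u) = h s * kker H1 H2 s u
          * (s powr (1/2 - H1) * s powr (H1 - 1/2)) * (u powr (1/2 - H1) * u powr (H1 - 1/2))"
        using True u by (simp add: weighted_def \<kappa>_eq_kker z_def mult_ac)
      then show ?thesis using True u pw by simp
    qed (simp add: weighted_def)
    have "integrable lborel (\<lambda>s. weighted h s * \<kappa> s u)"
      by (rule integrable_mult_sq_integrable[OF assms])
         (simp add: sq_integrable_def \<kappa>_square_integrable)
    then have 1: "set_integrable lborel {0<..T} (\<lambda>s. h s * kker H1 H2 s u)"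
      unfolding set_integrable_def eq by simp
    have 2: "(LBINT s:{0<..T}. h s * kker H1 H2 s u) = z * (\<integral>s. weighted h s * \<kappa> s u \<partial>lborel)"
      unfolding set_lebesgue_integral_def eq by simp
    have 3: "\<gamma>\<^sup>2 * u powr (1 - 2 * H1) = z * (\<gamma>\<^sup>2 * weighted (\<lambda>_. 1) u)"
      "\<gamma>\<^sup>2 * h u * u powr (1 - 2 * H1) = z * (\<gamma>\<^sup>2 * weighted h u)"
      using u by (simp_all add: sq weighted_def z_def)
    show ?thesis
      unfolding 2 3 distrib_left[symmetric] mult_left_cancel[OF z] using 1 by auto
  qed
  moreover have "\<gamma>\<^sup>2 * weighted h u + (\<integral>s. weighted h s * \<kappa> s u \<partial>lborel) = \<gamma>\<^sup>2 * weighted (\<lambda>_. 1) u"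
    if "u \<notin> {0<..T}" for u
    using that by (simp add: weighted_def \<kappa>_outside)
  ultimately show ?thesis unfolding solves_eq_def by blast
qed

lemma unique_solution:
  assumes "\<gamma> > 0"
  shows "\<exists>h. admissible H1 T h \<and> solves_eq H1 H2 \<gamma> T h \<and>
    (\<forall>g. admissible H1 T g \<and> solves_eq H1 H2 \<gamma> T g \<longrightarrow> (\<forall>u\<in>{0<..T}. g u = h u))"
proof -
  interpret gram: gram_kernel lborel lborel D \<kappa>
    by (rule gram_kernel_D)
  have \<gamma>: "0 < \<gamma>\<^sup>2" using assms by simp
  define b where "b = (\<lambda>u. \<gamma>\<^sup>2 * weighted (\<lambda>_. 1) u)"
  have "integrable lborel (\<lambda>u. indicator {0<..T} u * u powr - (2 * H1 - 1))"
    using H T by (intro integrable_powr_from_0) auto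
  \<comment> \<open>The right-hand side is square integrable because
    \<open>2 * H1 - 1 < 1\<close>.\<close>
  moreover have "(weighted (\<lambda>_. 1) u)\<^sup>2 = indicator {0<..T} u * u powr - (2 * H1 - 1)" for u
    by (simp add: weighted_def power2_eq_square indicator_def flip: powr_add)
  ultimately have "sq_integrable lborel b"
    unfolding b_def by (intro sq_integrable_cmult) (simp add: sq_integrable_def weighted_def)
  from gram.ex_solution[OF this \<gamma>] obtain f where
    f: "sq_integrable lborel f" and eq: "\<And>u. \<gamma>\<^sup>2 * f u + gram.A f u = b u"
    by auto
  define h where "h = (\<lambda>u. f u * u powr (H1 - 1/2))"
  have "weighted h u = f u" for u
  proof (cases "u \<in> {0<..T}")
    case True
    then show ?thesis by (simp add: weighted_def h_def mult.assoc flip: powr_add)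
  next
    \<comment> \<open>The equation forces \<open>f u = 0\<close> here, since \<kappa> and
      \<open>b\<close> vanish outside \<open>{0<..T}\<close>.\<close>
    case False
    then show ?thesis
      using eq[of u] \<gamma> by (simp add: weighted_def b_def gram.A_def \<kappa>_outside)
  qed
  then have hf: "weighted h = f" by auto
  show ?thesis
  proof (intro exI[of _ h] conjI allI impI ballI)
    show "admissible H1 T h" using f by (simp add: admissible_iff hf)
    show "solves_eq H1 H2 \<gamma> T h"
      using eq f by (simp add: solves_eq_iff hf gram.A_def b_def)
    fix g u assume g: "admissible H1 T g \<and> solves_eq H1 H2 \<gamma> T g" and u: "u \<in> {0<..T}"
    then have gI: "sq_integrable lborel (weighted g)" by (simp add: admissible_iff)
    have eq': "\<gamma>\<^sup>2 * weighted g u + gram.A (weighted g) u = b u" for u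
      using g solves_eq_iff[OF gI] by (simp add: gram.A_def b_def)
    have "weighted g u = f u"
      by (rule gram.unique_solution[OF gI f \<gamma> eq' eq]) simp
    then show "g u = h u" using u by (simp add: weighted_def flip: hf)
  qed
qed

end

theorem theorem2p3:
  fixes H1 H2 \<gamma> :: real
  assumes "1/2 < H1" "H1 < H2" "H2 < 1" "H2 - H1 > 1/4" "\<gamma> > 0"
  shows "\<exists>T :: nat \<Rightarrow> real. filterlim T at_top sequentially \<and>
           (\<forall>n. \<exists>h. admissible H1 (T n) h \<and> solves_eq H1 H2 \<gamma> (T n) h \<and>
                  (\<forall>g. admissible H1 (T n) g \<and> solves_eq H1 H2 \<gamma> (T n) g \<longrightarrow>
                        (\<forall>u\<in>{0<..T n}. g u = h u)))"
\<comment> \<open>Any positive sequence tending to infinity serves; \<open>Suc\<close> makes the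
  term at \<open>n = 0\<close> positive.\<close>
proof (intro exI[of _ "\<lambda>n. real (Suc n)"] conjI allI)
  show "filterlim (\<lambda>n. real (Suc n)) at_top sequentially"
    by (rule filterlim_compose[OF filterlim_real_sequentially filterlim_Suc])
  show "\<exists>h. admissible H1 (real (Suc n)) h \<and> solves_eq H1 H2 \<gamma> (real (Suc n)) h \<and>
      (\<forall>g. admissible H1 (real (Suc n)) g \<and> solves_eq H1 H2 \<gamma> (real (Suc n)) g \<longrightarrow>
        (\<forall>u\<in>{0<..real (Suc n)}. g u = h u))" for n
    by (intro molchan_kernel.unique_solution molchan_kernel.intro assms) simp
qed

end
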